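(* Let $r\ge 2$ and let $t_i\ge 2$ $(1\le i\le r)$ be fixed integers. Then for every $\varepsilon>0$, $$\sum_{\substack{n_1,\ldots,n_r\le x \\ \gcd(n_1,\ldots,n_r)=1}} \tau_{t_1}(n_1) \cdots \tau_{t_r}(n_r) = x^r Q(\log x)+ O\bigl(x^{r-1+\max_{1\le i\le r} \vartheta_{t_i} +\varepsilon}\bigr),$$ where $Q(u)$ is a polynomial in $u$ of degree $t_1+\cdots+t_r-r$ having the leading coefficient $$\frac{\Delta(\tau_{t_1},\ldots,\tau_{t_r},1,\ldots,1)}{(t_1-1)!\cdots (t_r-1)!},$$ with $$\Delta(\tau_{t_1},\ldots,\tau_{t_r},1,\ldots,1)= \prod_p \biggl(1+(-1)^{r-1} \sum_{1\le a_1,\ldots,a_r\le t} \frac1{p^{a_1+\cdots +a_r}} \prod_{i=1}^r (-1)^{a_i} \binom{t_i}{a_i}\biggr),\qquad t=\max_{1\le i\le r} t_i,$$ the product being over all primes $p$.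
   Context: $\tau_t(n)=\sum_{d_1\cdots d_t=n}1$ is the Piltz divisor function of order $t$ (the number of ordered $t$-tuples of positive integers with product $n$). $\binom{t_i}{a_i}=0$ if $a_i>t_i$. $\vartheta_{t_i}$ is the exponent in the Piltz divisor problem for $\tau_{t_i}$, namely a real number such that for every $\varepsilon>0$, $\sum_{n\le x}\tau_{t_i}(n)=xP_{t_i}(\log x)+O(x^{\vartheta_{t_i}+\varepsilon})$, with some polynomial $P_{t_i}(u)$ in $u$ of degree $t_i-1$ having leading coefficient $1/(t_i-1)!$. Asymptotics are as $x\to\infty$; implied constants may depend on $r$, the $t_i$ and $\varepsilon$. The variables $n_1,\ldots,n_r$ are positive integers. *)

theory Defs
  imports
    "HOL-Analysis.Analysis"
    "HOL-Library.Landau_Symbols"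
    "HOL-Library.FuncSet"
    "HOL-Computational_Algebra.Primes"
    "HOL-Computational_Algebra.Polynomial"
begin

text \<open>Ordered \<open>t\<close>-tuples are functions in \<open>{1..t} \<rightarrow>\<^sub>E _\<close>; the counted set is finite for every \<open>n\<close>.\<close>

definition piltz :: "nat \<Rightarrow> nat \<Rightarrow> nat" where
  "piltz t n = card {d \<in> {1..t} \<rightarrow>\<^sub>E {m::nat. m > 0}. (\<Prod>j=1..t. d j) = n}"

text \<open>
  The polynomial may not depend on \<open>\<epsilon>\<close>. An admissible \<open>\<theta>\<close> is any real number with this
  property, not necessarily the least one.
\<close>

definition piltz_exponent :: "nat \<Rightarrow> real \<Rightarrow> bool" where
  "piltz_exponent t \<theta> \<longleftrightarrow>
     (\<exists>P :: real poly. degree P = t - 1 \<and> lead_coeff P = 1 / fact (t - 1) \<and>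
       (\<forall>\<epsilon>>0. (\<lambda>x::real. (\<Sum>n | 1 \<le> n \<and> real n \<le> x. real (piltz t n)) - x * poly P (ln x))
                 \<in> O[at_top](\<lambda>x. x powr (\<theta> + \<epsilon>))))"

definition coprime_tuples :: "nat \<Rightarrow> real \<Rightarrow> (nat \<Rightarrow> nat) set" where
  "coprime_tuples r x =
     {n \<in> {1..r} \<rightarrow>\<^sub>E {m. 1 \<le> m \<and> real m \<le> x}. Gcd (n ` {1..r}) = 1}"

definition Delta_factor :: "nat \<Rightarrow> (nat \<Rightarrow> nat) \<Rightarrow> nat \<Rightarrow> real" where
  "Delta_factor r t p =
     1 + (-1) ^ (r - 1) *
       (\<Sum>a \<in> {1..r} \<rightarrow>\<^sub>E {1..Max (t ` {1..r})}.
          1 / real p ^ (\<Sum>i=1..r. a i) * (\<Prod>i=1..r. (-1) ^ a i * real (t i choose a i)))"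

text \<open>Products over primes are products over all naturals with factor \<open>1\<close> at the non-primes.\<close>

definition Delta_term :: "nat \<Rightarrow> (nat \<Rightarrow> nat) \<Rightarrow> nat \<Rightarrow> real" where
  "Delta_term r t p = (if prime p then Delta_factor r t p else 1)"

definition Delta :: "nat \<Rightarrow> (nat \<Rightarrow> nat) \<Rightarrow> real" where
  "Delta r t = (\<Prod>p. Delta_term r t p)"

end

theory Submission
  imports Defs
begin

text \<open>
  Let \<open>D\<close> range over the finite sets of primes. Inclusion-exclusion removes the coprimality
  condition: the sum equals \<open>\<Sum>\<^sub>D (-1)^|D| \<Prod>\<^sub>i T\<^sub>i\<^sub>,\<^sub>D(x)\<close>, where \<open>T\<^sub>i\<^sub>,\<^sub>D(x)\<close> is the sum of
  \<open>\<tau>\<^bsub>t i\<^esub>(n)\<close> over the \<open>n \<le> x\<close> divisible by every \<open>p \<in> D\<close>. A second inclusion-exclusion, over the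
  factors divisible by \<open>p\<close> in a tuple counted by \<open>\<tau>\<^bsub>t i\<^esub>(n)\<close>, writes \<open>T\<^sub>i\<^sub>,\<^sub>D(x)\<close> as a signed sum of
  values \<open>S\<^sub>i(x / e)\<close> of the unrestricted summatory function, with \<open>e \<ge> \<Prod>D\<close>. Inserting
  \<open>S\<^sub>i(y) = y P\<^sub>i(ln y) + O(y\<^sup>\<kappa>)\<close>, which holds for all \<open>y > 0\<close> when \<open>\<kappa> < 1\<close>, gives main terms
  \<open>x P\<^sub>i\<^sub>,\<^sub>D(ln x)\<close>. All resulting series over \<open>D\<close> are dominated by
  \<open>\<Sum>\<^sub>D \<Prod>\<^bsub>p \<in> D\<^esub> K p\<^bsup>-\<sigma>\<^esup> \<le> exp (K \<Sum>\<^sub>p p\<^bsup>-\<sigma>\<^esup>)\<close> with \<open>\<sigma> > 1\<close>. If the largest exponent is at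
  least 1, the claim follows from \<open>S\<^sub>i(x) = O(x\<^bsup>1+\<delta>\<^esup>)\<close> alone.
\<close>

section \<open>Growth of powers, polynomials and products\<close>

lemma prod_of_bool_eq:
  "finite A \<Longrightarrow> (\<Prod>x\<in>A. of_bool (b x) :: 'a::comm_semiring_1) = of_bool (\<forall>x\<in>A. b x)"
  by (induction A rule: finite_induct) auto

lemma power_le_exp:
  fixes \<omega> :: real
  assumes "\<omega> > 0"
  obtains C where "C > 0" "\<And>u. u \<ge> 0 \<Longrightarrow> (1 + u) ^ n \<le> C * exp (\<omega> * u)"
proof
  \<comment> \<open>With this \<open>c\<close>, \<open>c * (1 + u)\<close> is at most
    \<open>1 + \<omega> * u / (n + 1)\<close>, hence at most an exponential whose
    \<open>n\<close>-th power stays below \<open>exp (\<omega> * u)\<close>; undoing the scaling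
    costs \<open>c ^ n\<close>. The \<open>+ 1\<close> avoids a zero denominator at
    \<open>n = 0\<close>.\<close>
  define c where "c = min 1 (\<omega> / (real n + 1))"
  show "inverse (c ^ n) > 0"
    using assms by (simp add: c_def)
  have c: "c > 0" "c \<le> 1" "c \<le> \<omega> / (real n + 1)"
    using assms by (auto simp: c_def)
  fix u :: real assume u: "u \<ge> 0"
  have "c * (1 + u) \<le> 1 + \<omega> / (real n + 1) * u"
    using c u mult_right_mono[OF c(3) u] by (simp add: algebra_simps)
  also have "\<dots> \<le> exp (\<omega> / (real n + 1) * u)"
    by (rule exp_ge_add_one_self)
  finally have "(c * (1 + u)) ^ n \<le> exp (\<omega> / (real n + 1) * u) ^ n"
    using c u by (intro power_mono) auto
  also have "\<dots> = exp (real n * (\<omega> / (real n + 1) * u))"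
    by (rule exp_of_nat_mult [symmetric])
  also have "real n * (\<omega> / (real n + 1) * u) \<le> \<omega> * u"
    using assms u by (simp add: field_simps)
  finally have "c ^ n * (1 + u) ^ n \<le> exp (\<omega> * u)"
    by (simp add: power_mult_distrib)
  then show "(1 + u) ^ n \<le> inverse (c ^ n) * exp (\<omega> * u)"
    using c(1) by (simp add: field_simps)
qed

lemma power_ln_le_powr:
  fixes \<omega> :: real
  assumes "\<omega> > 0"
  obtains C where "C > 0" "\<And>y. y \<ge> 1 \<Longrightarrow> (1 + ln y) ^ n \<le> C * y powr \<omega>"
proof -
  obtain C where C: "C > 0" "\<And>u. u \<ge> 0 \<Longrightarrow> (1 + u) ^ n \<le> C * exp (\<omega> * u)"
    using power_le_exp[OF assms] by blast
  show ?thesis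
    using C(2)[of "ln y" for y] by (intro that[OF C(1)]) (simp add: powr_def)
qed

lemma abs_poly_le_power:
  fixes P :: "real poly"
  obtains C n where "C > 0" "\<And>u. \<bar>poly P u\<bar> \<le> C * (1 + \<bar>u\<bar>) ^ n"
proof -
  have "\<exists>C>0. \<forall>u. \<bar>poly P u\<bar> \<le> C * (1 + \<bar>u\<bar>) ^ degree P"
  proof (intro exI conjI allI)
    \<comment> \<open>The extra 1 keeps the constant positive when \<open>P\<close> is zero.\<close>
    show "1 + (\<Sum>i\<le>degree P. \<bar>coeff P i\<bar>) > 0"
      by (smt (verit) sum_nonneg abs_ge_zero)
    fix u :: real
    have "\<bar>poly P u\<bar> \<le> (\<Sum>i\<le>degree P. \<bar>coeff P i\<bar> * \<bar>u\<bar> ^ i)"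
      unfolding poly_altdef by (rule order_trans[OF sum_abs]) (simp add: abs_mult power_abs)
    also have "\<dots> \<le> (\<Sum>i\<le>degree P. \<bar>coeff P i\<bar> * (1 + \<bar>u\<bar>) ^ degree P)"
    proof (intro sum_mono mult_left_mono)
      fix i assume "i \<in> {..degree P}"
      have "\<bar>u\<bar> ^ i \<le> (1 + \<bar>u\<bar>) ^ i"
        by (intro power_mono) auto
      also have "\<dots> \<le> (1 + \<bar>u\<bar>) ^ degree P"
        using \<open>i \<in> _\<close> by (intro power_increasing) auto
      finally show "\<bar>u\<bar> ^ i \<le> (1 + \<bar>u\<bar>) ^ degree P" .
    qed auto
    also have "\<dots> = (\<Sum>i\<le>degree P. \<bar>coeff P i\<bar>) * (1 + \<bar>u\<bar>) ^ degree P"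
      by (simp add: sum_distrib_right)
    also have "\<dots> \<le> (1 + (\<Sum>i\<le>degree P. \<bar>coeff P i\<bar>)) * (1 + \<bar>u\<bar>) ^ degree P"
      by (intro mult_right_mono) auto
    finally show "\<bar>poly P u\<bar> \<le> \<dots>" .
  qed
  then show ?thesis using that by blast
qed

text \<open>Horner's scheme: if \<open>R\<close> is the shift of \<open>P\<close>, then
  \<open>pCons a P\<close> shifts to \<open>a + (X - c) R\<close>, so each induction step costs at
  most one more factor \<open>1 + c\<close>. With \<open>c = ln e\<close> this shows that replacing
  \<open>x\<close> by \<open>x / e\<close> changes the coefficients of the main term only by powers
  of \<open>ln e\<close>.\<close>

lemma coeff_pcompose_shift_le:
  fixes P :: "real poly"
  shows "\<exists>C\<ge>0. \<exists>n. \<forall>c\<ge>0. \<forall>j. \<bar>coeff (pcompose P [:- c, 1:]) j\<bar> \<le> C * (1 + c) ^ n"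
proof (induction P)
  case 0
  then show ?case by (intro exI[of _ 0]) auto
next
  case (pCons a P)
  then obtain C n where C: "C \<ge> 0"
    "\<And>c j. c \<ge> 0 \<Longrightarrow> \<bar>coeff (pcompose P [:- c, 1:]) j\<bar> \<le> C * (1 + c) ^ n"
    by blast
  have "\<bar>coeff (pcompose (pCons a P) [:- c, 1:]) j\<bar> \<le> (\<bar>a\<bar> + C) * (1 + c) ^ Suc n"
    if c: "c \<ge> 0" for c j
  proof -
    define R where "R = pcompose P [:- c, 1:]"
    have R: "\<bar>coeff R i\<bar> \<le> C * (1 + c) ^ n" for i
      using C(2)[OF c] by (simp add: R_def)
    have "coeff (pcompose (pCons a P) [:- c, 1:]) j =
        (case j of 0 \<Rightarrow> a | Suc _ \<Rightarrow> 0) - c * coeff R j + (case j of 0 \<Rightarrow> 0 | Suc i \<Rightarrow> coeff R i)"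
      by (simp add: pcompose_pCons R_def coeff_pCons split: nat.splits)
    also have "\<bar>\<dots>\<bar> \<le> \<bar>a\<bar> + c * (C * (1 + c) ^ n) + C * (1 + c) ^ n"
    proof -
      have "\<bar>c * coeff R j\<bar> \<le> c * (C * (1 + c) ^ n)"
        using c R[of j] by (simp add: abs_mult mult_left_mono)
      moreover have "0 \<le> C * (1 + c) ^ n" using C(1) c by simp
      ultimately show ?thesis
        using R[of "j - 1"] by (cases j) auto
    qed
    also have "\<dots> = \<bar>a\<bar> * 1 + C * (1 + c) ^ Suc n"
      by (simp add: algebra_simps)
    also have "\<dots> \<le> \<bar>a\<bar> * (1 + c) ^ Suc n + C * (1 + c) ^ Suc n"
      using c by (intro add_right_mono mult_left_mono one_le_power) auto
    finally show ?thesis by (simp add: algebra_simps)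
  qed
  with C(1) show ?case
    by (intro exI[of _ "\<bar>a\<bar> + C"] conjI exI[of _ "Suc n"]) auto
qed

lemma coeff_pcompose_ln_le_powr:
  fixes P :: "real poly"
  assumes "\<delta> > 0"
  obtains C where "C > 0"
    "\<And>y j. y \<ge> 1 \<Longrightarrow> \<bar>coeff (pcompose P [:- ln y, 1:]) j\<bar> \<le> C * y powr \<delta>"
proof -
  obtain A n where A: "A \<ge> 0"
    "\<And>c j. c \<ge> 0 \<Longrightarrow> \<bar>coeff (pcompose P [:- c, 1:]) j\<bar> \<le> A * (1 + c) ^ n"
    using coeff_pcompose_shift_le[of P] by blast
  obtain B where B: "B > 0" "\<And>y. y \<ge> 1 \<Longrightarrow> (1 + ln y) ^ n \<le> B * y powr \<delta>"
    using power_ln_le_powr[OF assms] by blast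
  show ?thesis
  proof (rule that)
    show "A * B + 1 > 0" using A B by (simp add: add_nonneg_pos)
    fix y :: real and j assume y: "y \<ge> 1"
    have "\<bar>coeff (pcompose P [:- ln y, 1:]) j\<bar> \<le> A * (1 + ln y) ^ n"
      using y by (intro A) auto
    also have "\<dots> \<le> A * (B * y powr \<delta>)"
      using A B y by (intro mult_left_mono) auto
    also have "\<dots> \<le> (A * B + 1) * y powr \<delta>" by (simp add: algebra_simps)
    finally show "\<bar>coeff (pcompose P [:- ln y, 1:]) j\<bar> \<le> (A * B + 1) * y powr \<delta>" .
  qed
qed

text \<open>The degree bound leaves at most \<open>n + 1\<close> nonzero terms in every convolution
  sum, so each further factor multiplies the bound by \<open>(n + 1) * B\<close>.\<close>

lemma abs_coeff_prod_le:
  fixes f :: "'i \<Rightarrow> real poly"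
  assumes "finite I" "\<And>i. i \<in> I \<Longrightarrow> degree (f i) \<le> n" "B \<ge> 0"
    "\<And>i j. i \<in> I \<Longrightarrow> \<bar>coeff (f i) j\<bar> \<le> B"
  shows "\<bar>coeff (\<Prod>i\<in>I. f i) j\<bar> \<le> (real (n + 1) * B) ^ card I"
  using assms(1,2,4)
proof (induction I arbitrary: j rule: finite_induct)
  case empty
  then show ?case by (auto simp: coeff_1)
next
  case (insert x I)
  have "coeff (\<Prod>i\<in>insert x I. f i) j = (\<Sum>k\<le>j. coeff (f x) k * coeff (\<Prod>i\<in>I. f i) (j - k))"
    using insert.hyps by (simp add: coeff_mult)
  also have "\<dots> = (\<Sum>k\<in>{..j} \<inter> {..n}. coeff (f x) k * coeff (\<Prod>i\<in>I. f i) (j - k))"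
    using insert.prems(1)[of x] by (intro sum.mono_neutral_right) (auto intro!: coeff_eq_0)
  also have "\<bar>\<dots>\<bar> \<le> (\<Sum>k\<in>{..j} \<inter> {..n}. B * (real (n + 1) * B) ^ card I)"
    by (rule order_trans[OF sum_abs], unfold abs_mult, intro sum_mono mult_mono)
       (use insert assms(3) in auto)
  also have "\<dots> = real (card ({..j} \<inter> {..n})) * (B * (real (n + 1) * B) ^ card I)"
    by simp
  also have "\<dots> \<le> real (n + 1) * (B * (real (n + 1) * B) ^ card I)"
  proof (rule mult_right_mono)
    have "card ({..j} \<inter> {..n}) \<le> card {..n}" by (intro card_mono) auto
    then show "real (card ({..j} \<inter> {..n})) \<le> real (n + 1)" by simp
  qed (use assms(3) in auto)
  finally show ?case using insert.hyps by (simp add: mult_ac)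
qed

text \<open>Only the term \<open>k = n x\<close> survives in the convolution at the top index. Upper
  bounds \<open>n i\<close> replace exact degrees, so no leading coefficient has to be known to be
  nonzero.\<close>

lemma coeff_prod_sum_degrees:
  fixes f :: "'i \<Rightarrow> real poly"
  assumes "finite I" "\<And>i. i \<in> I \<Longrightarrow> degree (f i) \<le> n i"
  shows "degree (\<Prod>i\<in>I. f i) \<le> (\<Sum>i\<in>I. n i) \<and>
    coeff (\<Prod>i\<in>I. f i) (\<Sum>i\<in>I. n i) = (\<Prod>i\<in>I. coeff (f i) (n i))"
  using assms
proof (induction I rule: finite_induct)
  case (insert x I)
  let ?q = "\<Prod>i\<in>I. f i" and ?N = "\<Sum>i\<in>I. n i"
  have dx: "degree (f x) \<le> n x" and dq: "degree ?q \<le> ?N"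
    using insert by auto
  have "degree (f x * ?q) \<le> n x + ?N"
    using degree_mult_le[of "f x" ?q] dx dq by linarith
  moreover have "coeff (f x * ?q) (n x + ?N) = coeff (f x) (n x) * coeff ?q ?N"
  proof -
    have "coeff (f x) k * coeff ?q (n x + ?N - k) = 0" if "k \<noteq> n x" for k
    proof (cases "k < n x")
      case True
      then have "degree ?q < n x + ?N - k" using dq by linarith
      then show ?thesis by (simp add: coeff_eq_0)
    next
      case False
      with that dx have "degree (f x) < k" by linarith
      then show ?thesis by (simp add: coeff_eq_0)
    qed
    then have "(\<Sum>k\<le>n x + ?N. coeff (f x) k * coeff ?q (n x + ?N - k)) =
        (\<Sum>k\<in>{n x}. coeff (f x) k * coeff ?q (n x + ?N - k))"
      by (intro sum.mono_neutral_right) auto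
    then show ?thesis by (simp add: coeff_mult)
  qed
  ultimately show ?case using insert by simp
qed auto

text \<open>Dividing every factor by \<open>U\<close> brings it into the unit ball, where the
  difference of two products is at most the sum of the differences of the factors.\<close>

lemma abs_prod_diff_le:
  fixes a b :: "'i \<Rightarrow> real"
  assumes "finite I" "U > 0" "\<And>i. i \<in> I \<Longrightarrow> \<bar>a i\<bar> \<le> U" "\<And>i. i \<in> I \<Longrightarrow> \<bar>b i\<bar> \<le> U"
    "\<And>i. i \<in> I \<Longrightarrow> \<bar>a i - b i\<bar> \<le> V"
  shows "\<bar>(\<Prod>i\<in>I. a i) - (\<Prod>i\<in>I. b i)\<bar> \<le> real (card I) * V * U ^ (card I - 1)"
proof (cases "I = {}")
  case False
  then have "card I > 0" using assms(1) by (simp add: card_gt_0_iff)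
  then have U: "U ^ card I = U * U ^ (card I - 1)" by (simp flip: power_Suc)
  have "\<bar>(\<Prod>i\<in>I. a i / U) - (\<Prod>i\<in>I. b i / U)\<bar> \<le> (\<Sum>i\<in>I. \<bar>a i / U - b i / U\<bar>)"
    using norm_prod_diff[of I "\<lambda>i. a i / U" "\<lambda>i. b i / U"] assms by simp
  also have "\<dots> \<le> (\<Sum>i\<in>I. V / U)"
    using assms by (intro sum_mono) (simp add: divide_right_mono flip: diff_divide_distrib)
  finally have "\<bar>(\<Prod>i\<in>I. a i) - (\<Prod>i\<in>I. b i)\<bar> / U ^ card I \<le> real (card I) * V / U"
    using assms(2) by (simp add: prod_dividef flip: diff_divide_distrib)
  then show ?thesis
    using assms(2) by (simp add: field_simps U)
qed auto

section \<open>Inclusion-exclusion over divisor tuples\<close>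

definition piltz_sum :: "nat \<Rightarrow> real \<Rightarrow> real" where
  "piltz_sum t x = (\<Sum>n | 1 \<le> n \<and> real n \<le> x. real (piltz t n))"

text \<open>The lattice points under the \<open>t\<close>-dimensional hyperbola. Working with tuples
  instead of their products lets divisibility by a prime be distributed over single
  coordinates.\<close>

definition piltz_tuples :: "nat \<Rightarrow> real \<Rightarrow> (nat \<Rightarrow> nat) set" where
  "piltz_tuples t x = {d \<in> {1..t} \<rightarrow>\<^sub>E {m. m > 0}. real (\<Prod>j=1..t. d j) \<le> x}"

definition divisible_piltz_sum :: "nat \<Rightarrow> nat set \<Rightarrow> real \<Rightarrow> real" where
  "divisible_piltz_sum t D x =
     (\<Sum>n | 1 \<le> n \<and> real n \<le> x \<and> (\<forall>p\<in>D. p dvd n). real (piltz t n))"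

text \<open>A choice \<open>\<phi>\<close> names, for each \<open>p\<close> in \<open>D\<close>, a
  nonempty set of coordinates that \<open>p\<close> is required to divide. The next two definitions
  give its inclusion-exclusion sign and the factor that these requirements force into the
  product.\<close>

definition prime_choices :: "nat \<Rightarrow> nat set \<Rightarrow> (nat \<Rightarrow> nat set) set" where
  "prime_choices t D = D \<rightarrow>\<^sub>E (Pow {1..t} - {{}})"

definition choice_sign :: "nat set \<Rightarrow> (nat \<Rightarrow> nat set) \<Rightarrow> real" where
  "choice_sign D \<phi> = (\<Prod>p\<in>D. (-1) ^ Suc (card (\<phi> p)))"

definition choice_modulus :: "nat set \<Rightarrow> (nat \<Rightarrow> nat set) \<Rightarrow> nat" where
  "choice_modulus D \<phi> = (\<Prod>p\<in>D. p ^ card (\<phi> p))"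

lemma finite_real_bounded_nats [simp]: "finite {n::nat. Suc 0 \<le> n \<and> real n \<le> x}"
  "finite {n::nat. Suc 0 \<le> n \<and> real n \<le> x \<and> P n}"
  by (rule finite_subset[of _ "{1..nat \<lfloor>x\<rfloor>}"]; auto simp: le_nat_floor)+

lemma le_prod_of_pos:
  fixes d :: "'i \<Rightarrow> nat"
  assumes "finite I" "j \<in> I" "\<And>i. i \<in> I \<Longrightarrow> d i > 0"
  shows "d j \<le> (\<Prod>i\<in>I. d i)"
  using assms by (intro dvd_imp_le prod_pos dvd_prodI) auto

lemma piltz_tuples_subset: "piltz_tuples t x \<subseteq> {1..t} \<rightarrow>\<^sub>E {1..nat \<lfloor>x\<rfloor>}"
proof
  fix d assume d: "d \<in> piltz_tuples t x"
  have "d j \<in> {1..nat \<lfloor>x\<rfloor>}" if "j \<in> {1..t}" for j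
  proof -
    have pos: "d i > 0" if "i \<in> {1..t}" for i
      using d that by (auto simp: piltz_tuples_def PiE_iff)
    have "d j \<le> (\<Prod>i=1..t. d i)"
      using that pos by (intro le_prod_of_pos) auto
    then have "real (d j) \<le> x"
      using d unfolding piltz_tuples_def by (simp del: of_nat_prod)
    then show ?thesis using pos[OF that] by (simp add: le_nat_floor)
  qed
  then show "d \<in> {1..t} \<rightarrow>\<^sub>E {1..nat \<lfloor>x\<rfloor>}"
    using d by (auto simp: piltz_tuples_def PiE_iff)
qed

lemma finite_piltz_tuples [simp]: "finite (piltz_tuples t x)"
  by (rule finite_subset[OF piltz_tuples_subset]) (auto intro: finite_PiE)

text \<open>The tuples are grouped by their product. The weight \<open>f\<close> is there to carry
  divisibility indicators.\<close>

lemma piltz_sum_weighted: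
  fixes f :: "nat \<Rightarrow> real"
  shows "(\<Sum>n | 1 \<le> n \<and> real n \<le> x. real (piltz t n) * f n) =
    (\<Sum>d\<in>piltz_tuples t x. f (\<Prod>j=1..t. d j))"
proof -
  let ?F = "\<lambda>n. {d \<in> {1..t} \<rightarrow>\<^sub>E {m. m > 0}. (\<Prod>j=1..t. d j) = n}"
  have "(\<Sum>d\<in>piltz_tuples t x. f (\<Prod>j=1..t. d j)) =
      (\<Sum>n | 1 \<le> n \<and> real n \<le> x. \<Sum>d | d \<in> piltz_tuples t x \<and> (\<Prod>j=1..t. d j) = n. f (\<Prod>j=1..t. d j))"
  proof (rule sum.group [symmetric])
    show "(\<lambda>d. \<Prod>j=1..t. d j) ` piltz_tuples t x \<subseteq> {n. 1 \<le> n \<and> real n \<le> x}"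
      by (auto simp: piltz_tuples_def PiE_iff Suc_le_eq simp del: of_nat_prod intro!: prod_pos)
  qed auto
  also have "\<dots> = (\<Sum>n | 1 \<le> n \<and> real n \<le> x. real (piltz t n) * f n)"
  proof (intro sum.cong refl)
    fix n :: nat assume n: "n \<in> {n. 1 \<le> n \<and> real n \<le> x}"
    have "{d. d \<in> piltz_tuples t x \<and> (\<Prod>j=1..t. d j) = n} = ?F n"
      using n by (auto simp: piltz_tuples_def)
    then show "(\<Sum>d | d \<in> piltz_tuples t x \<and> (\<Prod>j=1..t. d j) = n. f (\<Prod>j=1..t. d j)) = real (piltz t n) * f n"
      by (simp add: piltz_def)
  qed
  finally show ?thesis by simp
qed

lemma piltz_sum_eq_card: "piltz_sum t x = real (card (piltz_tuples t x))"
  using piltz_sum_weighted[where f = "\<lambda>_. 1"] by (simp add: piltz_sum_def)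

lemma divisible_piltz_sum_eq:
  "finite D \<Longrightarrow> divisible_piltz_sum t D x =
    (\<Sum>d\<in>piltz_tuples t x. \<Prod>p\<in>D. of_bool (p dvd (\<Prod>j=1..t. d j)))"
proof -
  assume D: "finite D"
  have "divisible_piltz_sum t D x =
      (\<Sum>n | 1 \<le> n \<and> real n \<le> x. real (piltz t n) * (\<Prod>p\<in>D. of_bool (p dvd n)))"
    unfolding divisible_piltz_sum_def
    by (rule sum.mono_neutral_cong_left) (use D in \<open>auto intro!: prod.neutral simp: prod_zero_iff\<close>)
  then show ?thesis
    by (simp only: piltz_sum_weighted)
qed

lemma prod_primes_dvd_iff:
  fixes D :: "nat set"
  assumes "finite D" "\<And>p. p \<in> D \<Longrightarrow> prime p"
  shows "\<Prod>D dvd n \<longleftrightarrow> (\<forall>p\<in>D. p dvd n)"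
  using assms
proof (induction D rule: finite_induct)
  case (insert p D)
  have "coprime p (\<Prod>D)"
    using insert by (intro prod_coprime_right) (auto intro!: primes_coprime)
  then show ?case
    using insert by (auto simp: divides_mult intro: dvd_mult_left dvd_mult_right)
qed auto

text \<open>A prime misses the product exactly when it misses every factor, so the indicator is one
  minus a product of complementary indicators. Expanding that product, the empty set cancels the 1
  and the remaining signs flip.\<close>

lemma of_bool_dvd_prod:
  fixes p :: nat
  assumes "prime p" "finite I"
  shows "(of_bool (p dvd (\<Prod>j\<in>I. d j)) :: real) =
    (\<Sum>J \<in> Pow I - {{}}. (-1) ^ Suc (card J) * of_bool (\<forall>j\<in>J. p dvd d j))"
proof -
  have "(of_bool (p dvd (\<Prod>j\<in>I. d j)) :: real) = 1 - (\<Prod>j\<in>I. 1 - of_bool (p dvd d j))"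
    using assms by (auto simp: prime_dvd_prod_iff prod_zero_iff intro!: prod.neutral)
  also have "(\<Prod>j\<in>I. 1 - of_bool (p dvd d j) :: real) =
      (\<Sum>J\<in>Pow I. (-1) ^ card J * of_bool (\<forall>j\<in>J. p dvd d j))"
    unfolding prod_diff_conv_sum[OF assms(2)]
    by (intro sum.cong) (use assms(2) in \<open>auto simp: prod_of_bool_eq finite_subset\<close>)
  also have "\<dots> = 1 + (\<Sum>J\<in>Pow I - {{}}. (-1) ^ card J * of_bool (\<forall>j\<in>J. p dvd d j))"
    using assms(2) by (subst sum.remove[of _ "{}"]) auto
  finally show ?thesis by (simp add: sum_negf)
qed

lemma finite_prime_choices [simp]: "finite D \<Longrightarrow> finite (prime_choices t D)"
  by (auto simp: prime_choices_def intro: finite_PiE)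

lemma choice_modulus_pos: "(\<And>p. p \<in> D \<Longrightarrow> prime p) \<Longrightarrow> choice_modulus D \<phi> > 0"
  unfolding choice_modulus_def by (intro prod_pos) (auto simp: prime_gt_0_nat)

text \<open>Let \<open>q j\<close> be the product of the primes required at coordinate
  \<open>j\<close>. Dividing coordinate \<open>j\<close> by \<open>q j\<close> is a bijection, and
  it divides the product of the coordinates by exactly
  \<open>choice_modulus D \<phi>\<close>.\<close>

lemma card_divisible_tuples:
  assumes "finite D" "\<And>p. p \<in> D \<Longrightarrow> prime p" "\<phi> \<in> prime_choices t D"
  shows "card {d \<in> piltz_tuples t x. \<forall>p\<in>D. \<forall>j\<in>\<phi> p. p dvd d j} =
    card (piltz_tuples t (x / real (choice_modulus D \<phi>)))"
proof -
  define q where "q j = \<Prod>{p \<in> D. j \<in> \<phi> p}" for j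
  have q_pos: "q j > 0" for j
    unfolding q_def using assms by (intro prod_pos) (auto simp: prime_gt_0_nat)
  have q_dvd: "q j dvd n \<longleftrightarrow> (\<forall>p\<in>D. j \<in> \<phi> p \<longrightarrow> p dvd n)" for j n
    unfolding q_def using assms by (subst prod_primes_dvd_iff) auto
  have \<phi>: "\<phi> p \<subseteq> {1..t}" if "p \<in> D" for p
    using assms(3) that by (auto simp: prime_choices_def PiE_iff)
  have q_prod: "(\<Prod>j=1..t. q j) = choice_modulus D \<phi>"
  proof -
    have "(\<Prod>j=1..t. q j) = (\<Prod>j=1..t. \<Prod>p\<in>D. if j \<in> \<phi> p then p else 1)"
      unfolding q_def using assms(1) by (intro prod.cong refl prod.inter_filter)
    also have "\<dots> = (\<Prod>p\<in>D. \<Prod>j=1..t. if j \<in> \<phi> p then p else 1)"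
      by (rule prod.swap)
    also have "\<dots> = (\<Prod>p\<in>D. p ^ card (\<phi> p))"
    proof (intro prod.cong refl)
      fix p assume "p \<in> D"
      then have "{1..t} \<inter> \<phi> p = \<phi> p" using \<phi> by blast
      then show "(\<Prod>j=1..t. if j \<in> \<phi> p then p else 1) = p ^ card (\<phi> p)"
        by (simp add: prod.If_cases)
    qed
    finally show ?thesis by (simp add: choice_modulus_def)
  qed
  have m: "choice_modulus D \<phi> > 0"
    using assms by (intro choice_modulus_pos)
  have "bij_betw (\<lambda>d. \<lambda>j\<in>{1..t}. d j * q j) (piltz_tuples t (x / real (choice_modulus D \<phi>)))
      {d \<in> piltz_tuples t x. \<forall>p\<in>D. \<forall>j\<in>\<phi> p. p dvd d j}"
  proof (rule bij_betw_byWitness[where f' = "\<lambda>d. \<lambda>j\<in>{1..t}. d j div q j"])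
    show "\<forall>d\<in>piltz_tuples t (x / real (choice_modulus D \<phi>)).
        (\<lambda>j\<in>{1..t}. (\<lambda>j\<in>{1..t}. d j * q j) j div q j) = d"
      using q_pos by (auto simp: piltz_tuples_def PiE_iff fun_eq_iff extensional_def less_imp_neq)
    show "\<forall>d\<in>{d \<in> piltz_tuples t x. \<forall>p\<in>D. \<forall>j\<in>\<phi> p. p dvd d j}.
        (\<lambda>j\<in>{1..t}. (\<lambda>j\<in>{1..t}. d j div q j) j * q j) = d"
    proof safe
      fix d assume d: "d \<in> piltz_tuples t x" "\<forall>p\<in>D. \<forall>j\<in>\<phi> p. p dvd d j"
      then have "q j dvd d j" for j by (auto simp: q_dvd)
      then show "(\<lambda>j\<in>{1..t}. (\<lambda>j\<in>{1..t}. d j div q j) j * q j) = d"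
        using d(1) by (auto simp: piltz_tuples_def PiE_iff fun_eq_iff extensional_def)
    qed
    show "(\<lambda>d. \<lambda>j\<in>{1..t}. d j * q j) ` piltz_tuples t (x / real (choice_modulus D \<phi>))
        \<subseteq> {d \<in> piltz_tuples t x. \<forall>p\<in>D. \<forall>j\<in>\<phi> p. p dvd d j}"
    proof safe
      fix d assume d: "d \<in> piltz_tuples t (x / real (choice_modulus D \<phi>))"
      have "real (\<Prod>j=1..t. d j) * real (choice_modulus D \<phi>) \<le> x"
        using d m by (simp add: piltz_tuples_def field_simps)
      then have "real (\<Prod>j=1..t. d j * q j) \<le> x"
        by (simp add: prod.distrib flip: q_prod)
      then show "(\<lambda>j\<in>{1..t}. d j * q j) \<in> piltz_tuples t x"
        using d q_pos by (auto simp: piltz_tuples_def PiE_iff)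
      fix p j assume "p \<in> D" "j \<in> \<phi> p"
      moreover have "q j dvd d j * q j" by simp
      ultimately show "p dvd (\<lambda>j\<in>{1..t}. d j * q j) j"
        using \<phi>[of p] by (subst (asm) q_dvd) auto
    qed
    show "(\<lambda>d. \<lambda>j\<in>{1..t}. d j div q j) ` {d \<in> piltz_tuples t x. \<forall>p\<in>D. \<forall>j\<in>\<phi> p. p dvd d j}
        \<subseteq> piltz_tuples t (x / real (choice_modulus D \<phi>))"
    proof safe
      fix d assume d: "d \<in> piltz_tuples t x" "\<forall>p\<in>D. \<forall>j\<in>\<phi> p. p dvd d j"
      have dvd: "q j dvd d j" for j using d(2) by (auto simp: q_dvd)
      have "(\<Prod>j=1..t. d j div q j) * choice_modulus D \<phi> = (\<Prod>j=1..t. d j)"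
        unfolding q_prod[symmetric] prod.distrib[symmetric] using dvd by (intro prod.cong) auto
      then have "real (\<Prod>j=1..t. d j div q j) * real (choice_modulus D \<phi>) \<le> x"
        using d(1) unfolding piltz_tuples_def of_nat_mult[symmetric] by simp
      moreover have "d j div q j > 0" if "j \<in> {1..t}" for j
        using dvd[of j] d(1) that q_pos[of j]
        by (auto simp: piltz_tuples_def PiE_iff div_greater_zero_iff intro!: dvd_imp_le)
      ultimately show "(\<lambda>j\<in>{1..t}. d j div q j) \<in> piltz_tuples t (x / real (choice_modulus D \<phi>))"
        using m by (auto simp: piltz_tuples_def field_simps)
    qed
  qed
  from bij_betw_same_card[OF this] show ?thesis by (rule sym)
qed

text \<open>Multiplying the expansions of \<open>of_bool_dvd_prod\<close> over \<open>p\<close> in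
  \<open>D\<close> turns a product of sums into a sum over choice functions; after swapping sums,
  each choice counts the tuples of \<open>card_divisible_tuples\<close>.\<close>

lemma divisible_piltz_sum_choices:
  assumes "finite D" "\<And>p. p \<in> D \<Longrightarrow> prime p"
  shows "divisible_piltz_sum t D x =
    (\<Sum>\<phi>\<in>prime_choices t D. choice_sign D \<phi> * piltz_sum t (x / real (choice_modulus D \<phi>)))"
proof -
  have "(\<Prod>p\<in>D. of_bool (p dvd (\<Prod>j=1..t. d j))) =
      (\<Sum>\<phi>\<in>prime_choices t D. choice_sign D \<phi> * of_bool (\<forall>p\<in>D. \<forall>j\<in>\<phi> p. p dvd d j))" for d
  proof -
    have "(\<Prod>p\<in>D. of_bool (p dvd (\<Prod>j=1..t. d j)) :: real) =
        (\<Prod>p\<in>D. \<Sum>J \<in> Pow {1..t} - {{}}. (-1) ^ Suc (card J) * of_bool (\<forall>j\<in>J. p dvd d j))"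
      using assms by (intro prod.cong refl of_bool_dvd_prod) auto
    also have "\<dots> = (\<Sum>\<phi>\<in>prime_choices t D.
        \<Prod>p\<in>D. (-1) ^ Suc (card (\<phi> p)) * of_bool (\<forall>j\<in>\<phi> p. p dvd d j))"
      unfolding prime_choices_def using assms by (intro prod_sum_PiE) auto
    also have "\<dots> = (\<Sum>\<phi>\<in>prime_choices t D. choice_sign D \<phi> * of_bool (\<forall>p\<in>D. \<forall>j\<in>\<phi> p. p dvd d j))"
    proof (intro sum.cong refl)
      fix \<phi>
      have "(\<Prod>p\<in>D. of_bool (\<forall>j\<in>\<phi> p. p dvd d j) :: real) = of_bool (\<forall>p\<in>D. \<forall>j\<in>\<phi> p. p dvd d j)"
        using assms(1) by (rule prod_of_bool_eq)
      then show "(\<Prod>p\<in>D. (-1) ^ Suc (card (\<phi> p)) * of_bool (\<forall>j\<in>\<phi> p. p dvd d j)) =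
          choice_sign D \<phi> * of_bool (\<forall>p\<in>D. \<forall>j\<in>\<phi> p. p dvd d j)"
        by (simp only: prod.distrib choice_sign_def)
    qed
    finally show ?thesis .
  qed
  then have "divisible_piltz_sum t D x = (\<Sum>d\<in>piltz_tuples t x. \<Sum>\<phi>\<in>prime_choices t D.
      choice_sign D \<phi> * of_bool (\<forall>p\<in>D. \<forall>j\<in>\<phi> p. p dvd d j))"
    by (simp only: divisible_piltz_sum_eq[OF assms(1)])
  also have "\<dots> = (\<Sum>\<phi>\<in>prime_choices t D. choice_sign D \<phi> *
      (\<Sum>d\<in>piltz_tuples t x. of_bool (\<forall>p\<in>D. \<forall>j\<in>\<phi> p. p dvd d j)))"
    unfolding sum_distrib_left by (rule sum.swap)
  also have "\<dots> = (\<Sum>\<phi>\<in>prime_choices t D. choice_sign D \<phi> *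
      piltz_sum t (x / real (choice_modulus D \<phi>)))"
  proof (intro sum.cong refl)
    fix \<phi> assume \<phi>: "\<phi> \<in> prime_choices t D"
    have "(\<Sum>d\<in>piltz_tuples t x. of_bool (\<forall>p\<in>D. \<forall>j\<in>\<phi> p. p dvd d j) :: real) =
        real (card {d \<in> piltz_tuples t x. \<forall>p\<in>D. \<forall>j\<in>\<phi> p. p dvd d j})"
      by (simp add: sum_of_bool_eq Int_def)
    also have "\<dots> = piltz_sum t (x / real (choice_modulus D \<phi>))"
      by (simp only: card_divisible_tuples[OF assms \<phi>] piltz_sum_eq_card)
    finally show "choice_sign D \<phi> * (\<Sum>d\<in>piltz_tuples t x. of_bool (\<forall>p\<in>D. \<forall>j\<in>\<phi> p. p dvd d j)) =
        choice_sign D \<phi> * piltz_sum t (x / real (choice_modulus D \<phi>))" by simp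
  qed
  finally show ?thesis .
qed

text \<open>Chosen sets are nonempty, so every modulus is at least the product of \<open>D\<close>;
  and there are fewer than \<open>2 ^ t\<close> possible sets for each prime.\<close>

lemma choice_modulus_powr_sum_le:
  assumes "finite D" "\<And>p. p \<in> D \<Longrightarrow> prime p" "s \<ge> 0"
  shows "(\<Sum>\<phi>\<in>prime_choices t D. real (choice_modulus D \<phi>) powr - s) \<le>
    (\<Prod>p\<in>D. 2 ^ t * real p powr - s)"
proof -
  have "(\<Sum>\<phi>\<in>prime_choices t D. real (choice_modulus D \<phi>) powr - s) \<le>
      (\<Sum>\<phi>\<in>prime_choices t D. \<Prod>p\<in>D. real p powr - s)"
  proof (rule sum_mono)
    fix \<phi> assume \<phi>: "\<phi> \<in> prime_choices t D"
    have pos: "real p \<ge> 1" if "p \<in> D" for p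
      using assms(2)[OF that] prime_ge_1_nat by (simp add: Suc_le_eq)
    have "(\<Prod>p\<in>D. p) \<le> choice_modulus D \<phi>"
      unfolding choice_modulus_def
    proof (rule prod_mono, safe)
      fix p assume p: "p \<in> D"
      then have "\<phi> p \<noteq> {}" "\<phi> p \<subseteq> {1..t}"
        using \<phi> by (auto simp: prime_choices_def PiE_iff)
      then have "card (\<phi> p) > 0"
        using finite_subset[of "\<phi> p" "{1..t}"] by (simp add: card_gt_0_iff)
      then show "p \<le> p ^ card (\<phi> p)"
        using pos[OF p] by (intro self_le_power) auto
    qed
    then have "real (choice_modulus D \<phi>) powr - s \<le> real (\<Prod>D) powr - s"
      using assms(3) assms(2)
      by (intro powr_mono2') (auto intro!: prod_pos simp: prime_gt_0_nat simp del: of_nat_prod)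
    also have "\<dots> = (\<Prod>p\<in>D. real p powr - s)"
      by (simp add: prod_powr_distrib)
    finally show "real (choice_modulus D \<phi>) powr - s \<le> (\<Prod>p\<in>D. real p powr - s)" .
  qed
  also have "\<dots> = (\<Prod>p\<in>D. real (card (Pow {1..t} - {{}})) * real p powr - s)"
    using assms(1) by (simp add: prime_choices_def card_PiE prod.distrib)
  also have "\<dots> \<le> (\<Prod>p\<in>D. 2 ^ t * real p powr - s)"
  proof (intro prod_mono conjI mult_right_mono mult_nonneg_nonneg)
    have "card (Pow {1..t} - {{}}) \<le> card (Pow {1..t})" by (intro card_mono) auto
    then show "real (card (Pow {1..t} - {{}})) \<le> 2 ^ t"
      by (simp only: card_Pow card_atLeastAtMost finite_atLeastAtMost flip: of_nat_le_iff) simp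
  qed auto
  finally show ?thesis .
qed

lemma abs_choice_sign [simp]: "\<bar>choice_sign D \<phi>\<bar> = 1"
  by (simp add: choice_sign_def abs_prod power_abs)

text \<open>The common shape of all bounds that depend on \<open>D\<close>. It is stable under
  products and powers, where the exponents \<open>s\<close> add up, and it is summable over all
  \<open>D\<close> as soon as \<open>s > 1\<close>.\<close>

definition prime_weight :: "real \<Rightarrow> real \<Rightarrow> nat set \<Rightarrow> real" where
  "prime_weight K s D = (\<Prod>p\<in>D. K * real p powr - s)"

lemma prime_weight_pos: "K > 0 \<Longrightarrow> (\<And>p. p \<in> D \<Longrightarrow> prime p) \<Longrightarrow> prime_weight K s D > 0"
  unfolding prime_weight_def by (intro prod_pos) (auto simp: prime_gt_0_nat)

lemma prime_weight_mult:
  "prime_weight K s D * prime_weight L u D = prime_weight (K * L) (s + u) D"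
  unfolding prime_weight_def prod.distrib[symmetric]
  by (intro prod.cong) (auto simp: powr_diff powr_minus field_simps)

lemma prime_weight_power:
  "(\<And>p. p \<in> D \<Longrightarrow> prime p) \<Longrightarrow> prime_weight K s D ^ n = prime_weight (K ^ n) (real n * s) D"
  unfolding prime_weight_def prod_power_distrib power_mult_distrib
  by (intro prod.cong) (auto simp: prime_gt_0_nat powr_power mult.commute)

text \<open>Applied with \<open>F e\<close> a coefficient of a shifted polynomial, a value of the
  summatory function at \<open>x / e\<close>, and its error there. Leaving \<open>K\<close> free
  above \<open>2 ^ t\<close> lets one weight serve all the orders \<open>t i\<close>.\<close>

lemma abs_choice_sum_le:
  assumes "finite D" "\<And>p. p \<in> D \<Longrightarrow> prime p" "s \<ge> 0" "A \<ge> 0" "2 ^ t \<le> K"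
    "\<And>e::nat. e > 0 \<Longrightarrow> \<bar>F e\<bar> \<le> A * real e powr - s"
  shows "\<bar>\<Sum>\<phi>\<in>prime_choices t D. choice_sign D \<phi> * F (choice_modulus D \<phi>)\<bar> \<le> A * prime_weight K s D"
proof -
  have "\<bar>\<Sum>\<phi>\<in>prime_choices t D. choice_sign D \<phi> * F (choice_modulus D \<phi>)\<bar> \<le>
      (\<Sum>\<phi>\<in>prime_choices t D. A * real (choice_modulus D \<phi>) powr - s)"
    using assms by (intro order_trans[OF sum_abs] sum_mono) (simp add: abs_mult choice_modulus_pos)
  also have "\<dots> \<le> A * (\<Prod>p\<in>D. 2 ^ t * real p powr - s)"
    unfolding sum_distrib_left[symmetric]
    using assms by (intro mult_left_mono choice_modulus_powr_sum_le) auto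
  also have "\<dots> \<le> A * prime_weight K s D"
    unfolding prime_weight_def using assms(4,5)
    by (intro mult_left_mono prod_mono conjI mult_right_mono) auto
  finally show ?thesis .
qed

text \<open>The sum factors over the primes of \<open>D\<close>, and each factor is a binomial
  expansion without its constant term. The value at \<open>p\<close> is the density of the integer
  \<open>t\<close>-tuples whose product is divisible by \<open>p\<close>.\<close>

lemma sum_choice_sign_div_modulus:
  assumes "finite D"
  shows "(\<Sum>\<phi>\<in>prime_choices t D. choice_sign D \<phi> / real (choice_modulus D \<phi>)) =
    (\<Prod>p\<in>D. 1 - (1 - 1 / real p) ^ t)"
proof -
  have "1 - (1 - 1 / real p) ^ t =
      (\<Sum>J\<in>Pow {1..t} - {{}}. (-1) ^ Suc (card J) * (1 / real p) ^ card J)" for p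
  proof -
    have "(1 - 1 / real p) ^ t = (\<Prod>j\<in>{1..t}. 1 - 1 / real p)" by simp
    also have "\<dots> = (\<Sum>J\<in>Pow {1..t}. (-1) ^ card J * (1 / real p) ^ card J)"
      by (subst prod_diff_conv_sum) auto
    also have "\<dots> = 1 + (\<Sum>J\<in>Pow {1..t} - {{}}. (-1) ^ card J * (1 / real p) ^ card J)"
      by (subst sum.remove[of _ "{}"]) auto
    finally show ?thesis by (simp add: sum_negf)
  qed
  then have "(\<Prod>p\<in>D. 1 - (1 - 1 / real p) ^ t) = (\<Sum>\<phi>\<in>prime_choices t D.
      \<Prod>p\<in>D. (-1) ^ Suc (card (\<phi> p)) * (1 / real p) ^ card (\<phi> p))"
    unfolding prime_choices_def using assms by (simp only:) (intro prod_sum_PiE, auto)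
  then show ?thesis
    by (simp add: choice_sign_def choice_modulus_def prod.distrib power_divide prod_dividef del: power_Suc)
qed

section \<open>Uniform bounds over sets of primes\<close>

lemma piltz_sum_nonneg: "piltz_sum t x \<ge> 0"
  by (simp add: piltz_sum_def sum_nonneg)

lemma piltz_sum_eq_0: "x < 1 \<Longrightarrow> piltz_sum t x = 0"
  unfolding piltz_sum_def by (intro sum.neutral) auto

text \<open>The sequence \<open>harm n - ln n\<close> decreases from its value 1 at
  \<open>n = 1\<close>.\<close>

lemma harm_le_ln: "n > 0 \<Longrightarrow> (harm n :: real) \<le> 1 + ln (real n)"
  using euler_mascheroni_sequence_decreasing[of 1 n] by (simp add: harm_expand)

text \<open>Each tuple is counted with weight \<open>x / (\<Prod>j=1..t. d j) \<ge> 1\<close>.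
  Extending the weighted sum to the whole box makes it factor into harmonic numbers.\<close>

lemma piltz_sum_le_harm:
  assumes "x \<ge> 1"
  shows "piltz_sum t x \<le> x * (1 + ln x) ^ t"
proof -
  define N where "N = nat \<lfloor>x\<rfloor>"
  have N: "N > 0" "real N \<le> x"
    using assms by (auto simp: N_def)
  have "piltz_sum t x = (\<Sum>d\<in>piltz_tuples t x. 1)"
    by (simp add: piltz_sum_eq_card)
  also have "\<dots> \<le> (\<Sum>d\<in>piltz_tuples t x. x / real (\<Prod>j=1..t. d j))"
  proof (rule sum_mono)
    fix d assume d: "d \<in> piltz_tuples t x"
    then have "(\<Prod>j=1..t. d j) > 0"
      by (intro prod_pos) (auto simp: piltz_tuples_def PiE_iff)
    then show "1 \<le> x / real (\<Prod>j=1..t. d j)"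
      using d by (simp add: piltz_tuples_def field_simps del: of_nat_prod)
  qed
  also have "\<dots> \<le> (\<Sum>d\<in>{1..t} \<rightarrow>\<^sub>E {1..N}. x / real (\<Prod>j=1..t. d j))"
  proof (intro sum_mono2)
    show "piltz_tuples t x \<subseteq> {1..t} \<rightarrow>\<^sub>E {1..N}"
      unfolding N_def by (rule piltz_tuples_subset)
  qed (use assms in \<open>auto intro!: finite_PiE prod_nonneg divide_nonneg_nonneg\<close>)
  also have "\<dots> = x * (\<Sum>d\<in>{1..t} \<rightarrow>\<^sub>E {1..N}. \<Prod>j=1..t. 1 / real (d j))"
    by (simp add: sum_distrib_left prod_dividef)
  also have "(\<Sum>d\<in>{1..t} \<rightarrow>\<^sub>E {1..N}. \<Prod>j=1..t. 1 / real (d j)) = (\<Prod>j=1..t. \<Sum>m=1..N. 1 / real m)"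
    by (subst prod_sum_PiE) auto
  also have "\<dots> = harm N ^ t"
    by (simp add: harm_def inverse_eq_divide)
  also have "x * harm N ^ t \<le> x * (1 + ln x) ^ t"
  proof (intro mult_left_mono power_mono)
    have "harm N \<le> 1 + ln (real N)" using N by (intro harm_le_ln)
    also have "\<dots> \<le> 1 + ln x" using N by simp
    finally show "harm N \<le> 1 + ln x" .
  qed (use assms in \<open>auto simp: harm_nonneg\<close>)
  finally show ?thesis .
qed

text \<open>Validity for every \<open>x > 0\<close>, and not just for large \<open>x\<close>,
  matters because the arguments \<open>x / e\<close> become arbitrarily small.\<close>

lemma piltz_sum_le_powr:
  assumes "\<delta> > 0"
  obtains C where "C > 0" "\<And>x. x > 0 \<Longrightarrow> piltz_sum t x \<le> C * x powr (1 + \<delta>)"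
proof -
  obtain C where C: "C > 0" "\<And>y. y \<ge> 1 \<Longrightarrow> (1 + ln y) ^ t \<le> C * y powr \<delta>"
    using power_ln_le_powr[OF assms] by blast
  show ?thesis
  proof (rule that[OF C(1)])
    fix x :: real assume x: "x > 0"
    show "piltz_sum t x \<le> C * x powr (1 + \<delta>)"
    proof (cases "x < 1")
      case True
      then show ?thesis using C(1) by (simp add: piltz_sum_eq_0)
    next
      case False
      then have "piltz_sum t x \<le> x * (1 + ln x) ^ t"
        by (intro piltz_sum_le_harm) auto
      also have "\<dots> \<le> x * (C * x powr \<delta>)"
        using False C by (intro mult_left_mono) auto
      finally show ?thesis using x by (simp add: powr_add mult_ac)
    qed
  qed
qed

lemma piltz_pos:
  assumes "t \<ge> 1" "n \<ge> 1"
  shows "piltz t n \<ge> 1"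
proof -
  let ?F = "{d \<in> {1..t} \<rightarrow>\<^sub>E {m. m > 0}. (\<Prod>j=1..t. d j) = n}"
  have "finite ?F"
    by (rule finite_subset[OF _ finite_piltz_tuples[of t "real n"]]) (auto simp: piltz_tuples_def)
  moreover have "(\<lambda>j\<in>{1..t}. if j = 1 then n else 1) \<in> ?F"
    using assms by auto
  ultimately have "card ?F > 0"
    by (subst card_gt_0_iff) blast
  then show ?thesis by (simp add: piltz_def)
qed

text \<open>The summatory function jumps by at least 1 at every integer, so the error cannot tend to 0.\<close>

lemma piltz_exponent_nonneg:
  assumes "piltz_exponent t \<theta>" "t \<ge> 1"
  shows "\<theta> \<ge> 0"
proof (rule ccontr)
  assume neg: "\<not> \<theta> \<ge> 0"
  obtain P where P: "\<And>\<epsilon>. \<epsilon> > 0 \<Longrightarrow>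
      (\<lambda>x. piltz_sum t x - x * poly P (ln x)) \<in> O[at_top](\<lambda>x. x powr (\<theta> + \<epsilon>))"
    using assms(1) unfolding piltz_exponent_def piltz_sum_def by blast
  \<comment> \<open>Taking \<open>\<epsilon> = - \<theta> / 2\<close> keeps the exponent
    \<open>\<theta> / 2\<close> negative, so the error tends to 0.\<close>
  have "(\<lambda>x. piltz_sum t x - x * poly P (ln x)) \<in> O[at_top](\<lambda>x. x powr (\<theta> / 2))"
    using P[of "- \<theta> / 2"] neg by (simp add: field_simps)
  moreover have "((\<lambda>x. x powr (\<theta> / 2)) \<longlongrightarrow> 0) at_top"
    using neg by (intro tendsto_neg_powr filterlim_ident) auto
  ultimately have "((\<lambda>x. piltz_sum t x - x * poly P (ln x)) \<longlongrightarrow> 0) at_top"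
    by (auto elim!: landau_o.bigE intro!: Lim_null_comparison[where g = "\<lambda>x. c * \<bar>x powr (\<theta> / 2)\<bar>" for c] tendsto_mult_right_zero tendsto_rabs_zero)
  \<comment> \<open>The jump at \<open>n\<close> is bounded by the error at \<open>n\<close>, the
    error just below \<open>n\<close>, and the variation of the main term between them. With 1/4 for
    each, the total stays below 1.\<close>
  then have "eventually (\<lambda>x. dist (piltz_sum t x - x * poly P (ln x)) 0 < 1 / 4) at_top"
    by (rule tendstoD) simp
  then obtain Y where Y: "\<And>x. x \<ge> Y \<Longrightarrow> \<bar>piltz_sum t x - x * poly P (ln x)\<bar> < 1 / 4"
    by (auto simp: eventually_at_top_linorder)
  define n where "n = nat \<lceil>max 1 Y\<rceil> + 1"
  have n: "real n \<ge> Y + 1" "n \<ge> 1"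
    unfolding n_def by linarith+
  have "isCont (\<lambda>x. x * poly P (ln x)) (real n)"
    using n by (intro continuous_intros) auto
  then obtain d where d: "d > 0"
    "\<And>x. dist x (real n) < d \<Longrightarrow> dist (x * poly P (ln x)) (real n * poly P (ln (real n))) < 1 / 4"
    unfolding continuous_at_eps_delta dist_real_def by (metis zero_less_divide_1_iff zero_less_numeral)
  \<comment> \<open>Close enough to \<open>n\<close> for the continuity estimate, and above
    \<open>n - 1\<close>, so that \<open>n\<close> is the only integer counted at \<open>n\<close>
    but not at \<open>y\<close>.\<close>
  define y where "y = real n - min (d / 2) (1 / 2)"
  have y: "y < real n" "y \<ge> real n - 1 / 2" "dist y (real n) < d"
    using d(1) by (auto simp: y_def dist_real_def)
  have "piltz_sum t (real n) = real (piltz t n) + piltz_sum t y"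
  proof -
    have "{m. 1 \<le> m \<and> real m \<le> real n} = insert n {m. 1 \<le> m \<and> real m \<le> y}"
      using y n by auto
    then show ?thesis
      unfolding piltz_sum_def using y by simp
  qed
  moreover have "real (piltz t n) \<ge> 1"
    using piltz_pos[OF assms(2) n(2)] by simp
  ultimately show False
    using Y[of "real n"] Y[of y] d(2)[OF y(3)] y n by (auto simp: dist_real_def abs_if split: if_splits)
qed

lemma exp_abs_ln_le:
  assumes "y > 0"
  shows "exp (\<omega> * \<bar>ln y\<bar>) \<le> y powr \<omega> + y powr - (\<omega>::real)"
  using assms by (cases "ln y \<ge> 0") (auto simp: powr_def)

text \<open>Turns the asymptotic bound into one for all \<open>x > 0\<close>. Below the threshold
  \<open>Y\<close> the summatory function and the main term are estimated separately; near 0 the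
  main term is \<open>x\<close> times powers of a logarithm, which \<open>x powr \<kappa>\<close>
  dominates because \<open>\<kappa> < 1\<close>.\<close>

lemma piltz_error_le_powr:
  assumes "(\<lambda>x. piltz_sum t x - x * poly P (ln x)) \<in> O[at_top](\<lambda>x. x powr \<kappa>)" "\<kappa> < 1"
  obtains C where "C > 0" "\<And>x. x > 0 \<Longrightarrow> \<bar>piltz_sum t x - x * poly P (ln x)\<bar> \<le> C * x powr \<kappa>"
proof -
  obtain c where c: "c > 0"
    "eventually (\<lambda>x. norm (piltz_sum t x - x * poly P (ln x)) \<le> c * norm (x powr \<kappa>)) at_top"
    using landau_o.bigE[OF assms(1)] by blast
  then obtain Y0 where Y0: "\<And>x. x \<ge> Y0 \<Longrightarrow> \<bar>piltz_sum t x - x * poly P (ln x)\<bar> \<le> c * x powr \<kappa>"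
    by (auto simp: eventually_at_top_linorder)
  define Y where "Y = max 1 Y0"
  \<comment> \<open>Then \<open>x powr (1 - \<omega>)\<close> is exactly
    \<open>x powr \<kappa>\<close>, and \<open>x powr (1 + \<omega>)\<close> exceeds it by
    \<open>x powr (2 * \<omega>)\<close>, which is bounded for \<open>x < Y\<close>.\<close>
  define \<omega> where "\<omega> = 1 - \<kappa>"
  have \<omega>: "\<omega> > 0" and Y: "Y \<ge> 1" using assms(2) by (auto simp: \<omega>_def Y_def)
  obtain C1 where C1: "C1 > 0" "\<And>x. x > 0 \<Longrightarrow> piltz_sum t x \<le> C1 * x powr (1 + \<omega>)"
    using piltz_sum_le_powr[OF \<omega>] by blast
  obtain A n where A: "A > 0" "\<And>u. \<bar>poly P u\<bar> \<le> A * (1 + \<bar>u\<bar>) ^ n"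
    using abs_poly_le_power by blast
  obtain B where B: "B > 0" "\<And>u. u \<ge> 0 \<Longrightarrow> (1 + u) ^ n \<le> B * exp (\<omega> * u)"
    using power_le_exp[OF \<omega>] by blast
  define C where "C = c + (C1 * Y powr (2 * \<omega>) + A * B * (Y powr (2 * \<omega>) + 1))"
  have C0: "C1 * Y powr (2 * \<omega>) + A * B * (Y powr (2 * \<omega>) + 1) \<ge> 0"
    using A B C1 by (intro add_nonneg_nonneg mult_nonneg_nonneg) auto
  show ?thesis
  proof (rule that)
    show "C > 0" using c C0 by (simp add: C_def)
    fix x :: real assume x: "x > 0"
    show "\<bar>piltz_sum t x - x * poly P (ln x)\<bar> \<le> C * x powr \<kappa>"
    proof (cases "x \<ge> Y")
      case True
      then have "\<bar>piltz_sum t x - x * poly P (ln x)\<bar> \<le> c * x powr \<kappa>"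
        by (intro Y0) (auto simp: Y_def)
      also have "\<dots> \<le> C * x powr \<kappa>"
        using C0 by (intro mult_right_mono) (auto simp: C_def)
      finally show ?thesis .
    next
      case False
      have split: "x powr (1 + \<omega>) \<le> Y powr (2 * \<omega>) * x powr \<kappa>"
      proof -
        have "x powr (1 + \<omega>) = x powr (2 * \<omega>) * x powr \<kappa>"
          by (simp add: \<omega>_def flip: powr_add)
        then show ?thesis
          using False \<omega> x by (auto intro!: mult_right_mono powr_mono2)
      qed
      have "piltz_sum t x \<le> C1 * (Y powr (2 * \<omega>) * x powr \<kappa>)"
        using C1(1) by (intro order_trans[OF C1(2)[OF x]] mult_left_mono split) auto
      moreover have "\<bar>x * poly P (ln x)\<bar> \<le> A * B * ((Y powr (2 * \<omega>) + 1) * x powr \<kappa>)"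
      proof -
        have "\<bar>x * poly P (ln x)\<bar> \<le> x * (A * (B * (x powr \<omega> + x powr - \<omega>)))"
          unfolding abs_mult
        proof (rule mult_mono)
          have "(1 + \<bar>ln x\<bar>) ^ n \<le> B * exp (\<omega> * \<bar>ln x\<bar>)" by (rule B) simp
          also have "\<dots> \<le> B * (x powr \<omega> + x powr - \<omega>)"
            using B x by (intro mult_left_mono exp_abs_ln_le) auto
          finally have "A * (1 + \<bar>ln x\<bar>) ^ n \<le> A * (B * (x powr \<omega> + x powr - \<omega>))"
            using A(1) by (intro mult_left_mono) auto
          then show "\<bar>poly P (ln x)\<bar> \<le> A * (B * (x powr \<omega> + x powr - \<omega>))"
            using A(2)[of "ln x"] by linarith
        qed (use x in auto)
        also have "\<dots> = A * B * (x powr (1 + \<omega>) + x powr \<kappa>)"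
          using x by (simp add: \<omega>_def powr_add powr_diff powr_minus field_simps power2_eq_square)
        also have "\<dots> \<le> A * B * ((Y powr (2 * \<omega>) + 1) * x powr \<kappa>)"
          using A B split by (intro mult_left_mono) (auto simp: algebra_simps)
        finally show ?thesis .
      qed
      moreover have "c * x powr \<kappa> \<ge> 0" using c by simp
      ultimately show ?thesis
        using piltz_sum_nonneg[of t x] unfolding C_def by (simp add: algebra_simps abs_le_iff)
    qed
  qed
qed

section \<open>Unordered sums over finite sets of primes\<close>

definition prime_sets :: "nat set set" where
  "prime_sets = {D. finite D \<and> D \<subseteq> {p. prime p}}"

lemma prime_setsD: "D \<in> prime_sets \<Longrightarrow> finite D" "D \<in> prime_sets \<Longrightarrow> p \<in> D \<Longrightarrow> prime p"
  by (auto simp: prime_sets_def)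

text \<open>A finite family of prime sets lies in the power set of its union, and the sum over a
  power set is a finite product of factors \<open>1 + c p\<close>.\<close>

lemma prod_summable_on_prime_sets:
  fixes c :: "nat \<Rightarrow> real"
  assumes "summable c" "\<And>p. c p \<ge> 0"
  shows "(\<lambda>D. \<Prod>p\<in>D. c p) summable_on prime_sets"
proof (rule nonneg_bdd_above_summable_on)
  show "bdd_above (sum (\<lambda>D. \<Prod>p\<in>D. c p) ` {F. F \<subseteq> prime_sets \<and> finite F})"
  proof (rule bdd_aboveI2)
    fix F assume F: "F \<in> {F. F \<subseteq> prime_sets \<and> finite F}"
    then have fin: "finite (\<Union>F)" by (auto simp: prime_sets_def)
    have "(\<Sum>D\<in>F. \<Prod>p\<in>D. c p) \<le> (\<Sum>D\<in>Pow (\<Union>F). \<Prod>p\<in>D. c p)"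
      using fin assms by (intro sum_mono2) (auto intro: prod_nonneg)
    also have "\<dots> = (\<Prod>p\<in>\<Union>F. c p + 1)"
      using fin by (subst prod_add) auto
    also have "\<dots> \<le> exp (\<Sum>p\<in>\<Union>F. c p)"
      using prod_le_exp_sum[of "\<Union>F" c] assms by (simp add: add.commute)
    also have "\<dots> \<le> exp (\<Sum>p. c p)"
      using assms fin by (simp add: sum_le_suminf)
    finally show "(\<Sum>D\<in>F. \<Prod>p\<in>D. c p) \<le> exp (\<Sum>p. c p)" .
  qed
qed (use assms in \<open>auto intro: prod_nonneg\<close>)

lemma prime_weight_summable:
  assumes "\<sigma> > 1" "K \<ge> 0"
  shows "prime_weight K \<sigma> summable_on prime_sets"
  unfolding prime_weight_def
  using assms by (intro prod_summable_on_prime_sets summable_mult) (auto simp: summable_real_powr_iff)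

text \<open>Absolute convergence comes from domination by \<open>c\<close>. The value is then read
  off along the power sets of the primes up to \<open>N\<close>, where the sum equals a partial
  Euler product.\<close>

lemma has_sum_prime_sets_prod:
  fixes f c :: "nat \<Rightarrow> real"
  assumes "summable c" "\<And>p. prime p \<Longrightarrow> \<bar>f p\<bar> \<le> c p" "\<And>p. c p \<ge> 0"
    "(\<lambda>N. \<Prod>p\<le>N. if prime p then 1 - f p else 1) \<longlonglongrightarrow> L"
  shows "((\<lambda>D. (-1) ^ card D * (\<Prod>p\<in>D. f p)) has_sum L) prime_sets"
proof -
  let ?g = "\<lambda>D. (-1) ^ card D * (\<Prod>p\<in>D. f p)"
  have "?g summable_on prime_sets"
  proof (rule abs_summable_summable[OF Infinite_Sum.abs_summable_on_comparison_test'[OF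
          prod_summable_on_prime_sets[OF assms(1,3)]]])
    fix D assume D: "D \<in> prime_sets"
    show "norm (?g D) \<le> (\<Prod>p\<in>D. c p)"
      using D by (auto simp: abs_mult power_abs abs_prod prime_sets_def intro!: prod_mono assms)
  qed
  then have sum: "(?g has_sum infsum ?g prime_sets) prime_sets" by simp
  \<comment> \<open>These power sets eventually contain every finite family of prime sets, so the
    unordered sum may be evaluated along them.\<close>
  have "filterlim (\<lambda>N. Pow {p. prime p \<and> p \<le> N}) (finite_subsets_at_top prime_sets) sequentially"
    unfolding filterlim_finite_subsets_at_top
  proof safe
    fix F assume F: "finite F" "F \<subseteq> prime_sets"
    then have "finite (\<Union>F)" by (auto simp: prime_sets_def)
    then obtain M where M: "\<forall>p\<in>\<Union>F. p \<le> M"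
      unfolding finite_nat_set_iff_bounded_le by (rule exE)
    show "\<forall>\<^sub>F N in sequentially. finite (Pow {p. prime p \<and> p \<le> N}) \<and>
        F \<subseteq> Pow {p. prime p \<and> p \<le> N} \<and> Pow {p. prime p \<and> p \<le> N} \<subseteq> prime_sets"
    proof (rule eventually_sequentiallyI[of M], intro conjI)
      fix N assume N: "M \<le> N"
      have fin: "finite {p. prime p \<and> p \<le> N}" by simp
      then show "finite (Pow {p. prime p \<and> p \<le> N})" by simp
      show "F \<subseteq> Pow {p. prime p \<and> p \<le> N}"
      proof (intro subsetI PowI CollectI conjI)
        fix D p assume D: "D \<in> F" "p \<in> D"
        then show "prime p" using F(2) by (auto simp: prime_sets_def)
        show "p \<le> N" using M N D by fastforce
      qed
      show "Pow {p. prime p \<and> p \<le> N} \<subseteq> prime_sets"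
        using fin by (auto simp: prime_sets_def intro: finite_subset[OF _ fin])
    qed
  qed
  with sum have "(\<lambda>N. sum ?g (Pow {p. prime p \<and> p \<le> N})) \<longlonglongrightarrow> infsum ?g prime_sets"
    unfolding has_sum_def by (rule filterlim_compose)
  moreover have "sum ?g (Pow {p. prime p \<and> p \<le> N}) = (\<Prod>p\<le>N. if prime p then 1 - f p else 1)" for N
  proof -
    have "(\<Prod>p\<le>N. if prime p then 1 - f p else 1) = (\<Prod>p\<in>{p. prime p \<and> p \<le> N}. 1 - f p)"
      by (intro prod.mono_neutral_cong_right) auto
    then show ?thesis by (simp add: prod_diff_conv_sum)
  qed
  ultimately have "infsum ?g prime_sets = L"
    using assms(4) LIMSEQ_unique by simp
  then show ?thesis using sum by simp
qed

text \<open>The local main polynomial: \<open>(x / e) P(ln (x / e))\<close> is \<open>x\<close>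
  times the polynomial \<open>P(u - ln e) / e\<close> at \<open>u = ln x\<close>, and these are
  combined with the inclusion-exclusion signs.\<close>

definition choice_poly :: "nat \<Rightarrow> real poly \<Rightarrow> nat set \<Rightarrow> real poly" where
  "choice_poly t P D = (\<Sum>\<phi>\<in>prime_choices t D.
     smult (choice_sign D \<phi> / real (choice_modulus D \<phi>))
       (pcompose P [:- ln (real (choice_modulus D \<phi>)), 1:]))"

lemma degree_choice_poly: "finite D \<Longrightarrow> degree (choice_poly t P D) \<le> degree P"
  unfolding choice_poly_def
  by (intro degree_sum_le order_trans[OF degree_smult_le]) (auto simp: degree_pcompose)

text \<open>A shift of the argument leaves the leading coefficient unchanged, so only the signed sum
  of the reciprocals of the moduli remains.\<close>

lemma coeff_degree_choice_poly:
  assumes "finite D"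
  shows "coeff (choice_poly t P D) (degree P) = lead_coeff P * (\<Prod>p\<in>D. 1 - (1 - 1 / real p) ^ t)"
proof -
  have "coeff (pcompose P [:- c, 1:]) (degree P) = lead_coeff P" for c :: real
    using lead_coeff_comp[of "[:- c, 1:]" P] by (simp add: degree_pcompose)
  then have "coeff (choice_poly t P D) (degree P) =
      (\<Sum>\<phi>\<in>prime_choices t D. choice_sign D \<phi> / real (choice_modulus D \<phi>)) * lead_coeff P"
    by (simp add: choice_poly_def coeff_sum sum_distrib_right)
  then show ?thesis
    by (simp add: sum_choice_sign_div_modulus[OF assms])
qed

lemma poly_choice_poly:
  assumes "\<And>p. p \<in> D \<Longrightarrow> prime p" "x > 0"
  shows "x * poly (choice_poly t P D) (ln x) = (\<Sum>\<phi>\<in>prime_choices t D. choice_sign D \<phi> *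
    (x / real (choice_modulus D \<phi>) * poly P (ln (x / real (choice_modulus D \<phi>)))))"
proof -
  have "ln (x / real (choice_modulus D \<phi>)) = - ln (real (choice_modulus D \<phi>)) + ln x" for \<phi>
    using choice_modulus_pos[OF assms(1)] assms(2) by (simp add: ln_div)
  then show ?thesis
    by (simp add: choice_poly_def poly_sum poly_pcompose sum_distrib_left mult_ac)
qed

text \<open>The shift by \<open>ln e\<close> costs \<open>e powr \<delta>\<close> and the division
  by \<open>e\<close> gains a full power, which leaves the exponent
  \<open>1 - \<delta>\<close>.\<close>

lemma coeff_choice_poly_le:
  assumes "\<delta> > 0" "\<delta> < 1" "2 ^ t \<le> K"
  obtains C where "C > 0" "\<And>D j. D \<in> prime_sets \<Longrightarrow>
    \<bar>coeff (choice_poly t P D) j\<bar> \<le> C * prime_weight K (1 - \<delta>) D"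
proof -
  obtain C where C: "C > 0"
    "\<And>y j. y \<ge> 1 \<Longrightarrow> \<bar>coeff (pcompose P [:- ln y, 1:]) j\<bar> \<le> C * y powr \<delta>"
    using coeff_pcompose_ln_le_powr[OF assms(1)] by blast
  show ?thesis
  proof (rule that[OF C(1)])
    fix D j assume D: "D \<in> prime_sets"
    have "coeff (choice_poly t P D) j = (\<Sum>\<phi>\<in>prime_choices t D. choice_sign D \<phi> *
        (coeff (pcompose P [:- ln (real (choice_modulus D \<phi>)), 1:]) j / real (choice_modulus D \<phi>)))"
      by (simp add: choice_poly_def coeff_sum)
    also have "\<bar>\<dots>\<bar> \<le> C * prime_weight K (1 - \<delta>) D"
    proof (rule abs_choice_sum_le[where F = "\<lambda>e. coeff (pcompose P [:- ln (real e), 1:]) j / real e"])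
      fix e :: nat assume e: "e > 0"
      have "\<bar>coeff (pcompose P [:- ln (real e), 1:]) j / real e\<bar> \<le> C * real e powr \<delta> / real e"
        using C(2)[of "real e" j] e by (simp add: divide_right_mono)
      also have "\<dots> = C * real e powr - (1 - \<delta>)"
        using e by (simp add: powr_diff)
      finally show "\<bar>coeff (pcompose P [:- ln (real e), 1:]) j / real e\<bar> \<le> C * real e powr - (1 - \<delta>)" .
    qed (use D C assms in \<open>auto simp: prime_sets_def\<close>)
    finally show "\<bar>coeff (choice_poly t P D) j\<bar> \<le> C * prime_weight K (1 - \<delta>) D" .
  qed
qed

text \<open>At most \<open>degree P + 1\<close> coefficients occur, whatever \<open>D\<close> is,
  and the powers of \<open>ln x\<close> cost only \<open>x powr \<delta>\<close>.\<close>

lemma poly_choice_poly_le: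
  assumes "\<delta> > 0" "\<delta> < 1" "2 ^ t \<le> K"
  obtains C where "C > 0" "\<And>D x. D \<in> prime_sets \<Longrightarrow> x \<ge> 1 \<Longrightarrow>
    \<bar>x * poly (choice_poly t P D) (ln x)\<bar> \<le>
      C * x powr (1 + \<delta>) * prime_weight K (1 - \<delta>) D"
proof -
  define n where "n = degree P"
  obtain A where A: "A > 0" "\<And>D j. D \<in> prime_sets \<Longrightarrow>
      \<bar>coeff (choice_poly t P D) j\<bar> \<le> A * prime_weight K (1 - \<delta>) D"
    using coeff_choice_poly_le[OF assms] by blast
  obtain B where B: "B > 0" "\<And>y. y \<ge> 1 \<Longrightarrow> (1 + ln y) ^ n \<le> B * y powr \<delta>"
    using power_ln_le_powr[OF assms(1)] by blast
  show ?thesis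
  proof (rule that)
    show "(real n + 1) * A * B > 0" using A B by simp
    fix D and x :: real assume D: "D \<in> prime_sets" and x: "x \<ge> 1"
    define W where "W = prime_weight K (1 - \<delta>) D"
    have "K > 0" using assms(3) by (rule less_le_trans[rotated]) simp
    then have W: "W \<ge> 0" unfolding W_def by (simp add: prime_weight_pos prime_setsD(2)[OF D] less_imp_le)
    have deg: "degree (choice_poly t P D) \<le> n"
      unfolding n_def using D by (intro degree_choice_poly prime_setsD)
    have "\<bar>poly (choice_poly t P D) (ln x)\<bar> =
        \<bar>\<Sum>j\<le>n. coeff (choice_poly t P D) j * ln x ^ j\<bar>"
      unfolding poly_altdef
      by (intro arg_cong[where f = abs] sum.mono_neutral_left) (use deg in \<open>auto simp: coeff_eq_0\<close>)
    also have "\<dots> \<le> (\<Sum>j\<le>n. A * W * (B * x powr \<delta>))"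
    proof (intro order_trans[OF sum_abs] sum_mono)
      fix j assume j: "j \<in> {..n}"
      have "ln x ^ j \<le> (1 + ln x) ^ j" using x by (intro power_mono) auto
      also have "\<dots> \<le> (1 + ln x) ^ n" using x j by (intro power_increasing) auto
      also have "\<dots> \<le> B * x powr \<delta>" using x by (rule B)
      finally show "\<bar>coeff (choice_poly t P D) j * ln x ^ j\<bar> \<le> A * W * (B * x powr \<delta>)"
        unfolding abs_mult using A(2)[OF D] A(1) W x by (intro mult_mono) (auto simp: W_def)
    qed
    also have "\<dots> = (real n + 1) * A * B * W * x powr \<delta>" by simp
    finally have "x * \<bar>poly (choice_poly t P D) (ln x)\<bar> \<le> x * ((real n + 1) * A * B * W * x powr \<delta>)"
      using x by (intro mult_left_mono) auto
    then show "\<bar>x * poly (choice_poly t P D) (ln x)\<bar> \<le> (real n + 1) * A * B * x powr (1 + \<delta>) *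
        prime_weight K (1 - \<delta>) D"
      using x unfolding W_def[symmetric] by (simp add: abs_mult powr_add mult_ac)
  qed
qed

lemma divide_powr_eq:
  fixes a x y :: real
  assumes "x \<ge> 0" "y \<ge> 0"
  shows "(x / y) powr a = x powr a * y powr - a"
  using assms by (simp add: powr_divide powr_minus_divide)

lemma divisible_piltz_sum_le:
  assumes "\<delta> > 0" "\<delta> < 1" "2 ^ t \<le> K"
  obtains C where "C > 0" "\<And>D x. D \<in> prime_sets \<Longrightarrow> x \<ge> 1 \<Longrightarrow>
    \<bar>divisible_piltz_sum t D x\<bar> \<le>
      C * x powr (1 + \<delta>) * prime_weight K (1 - \<delta>) D"
proof -
  obtain C where C: "C > 0" "\<And>x. x > 0 \<Longrightarrow> piltz_sum t x \<le> C * x powr (1 + \<delta>)"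
    using piltz_sum_le_powr[OF assms(1)] by blast
  show ?thesis
  proof (rule that[OF C(1)])
    fix D and x :: real assume D: "D \<in> prime_sets" and x: "x \<ge> 1"
    have eq: "divisible_piltz_sum t D x = (\<Sum>\<phi>\<in>prime_choices t D.
        choice_sign D \<phi> * piltz_sum t (x / real (choice_modulus D \<phi>)))"
      using prime_setsD[OF D] by (intro divisible_piltz_sum_choices) auto
    show "\<bar>divisible_piltz_sum t D x\<bar> \<le>
        C * x powr (1 + \<delta>) * prime_weight K (1 - \<delta>) D"
      unfolding eq
    proof (rule abs_choice_sum_le[where F = "\<lambda>e. piltz_sum t (x / real e)"])
      fix e :: nat assume e: "e > 0"
      have "piltz_sum t (x / real e) \<le> C * (x / real e) powr (1 + \<delta>)"
        using e x by (intro C) auto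
      also have "\<dots> = C * x powr (1 + \<delta>) * real e powr - (1 + \<delta>)"
        using x by (subst divide_powr_eq) auto
      \<comment> \<open>The stronger exponent \<open>1 + \<delta>\<close> is given up so that the
        restricted sums and their main terms share one bound.\<close>
      also have "\<dots> \<le> C * x powr (1 + \<delta>) * real e powr - (1 - \<delta>)"
        using e x C(1) assms by (intro mult_left_mono powr_mono) auto
      finally show "\<bar>piltz_sum t (x / real e)\<bar> \<le> C * x powr (1 + \<delta>) * real e powr - (1 - \<delta>)"
        using piltz_sum_nonneg[of t "x / real e"] by simp
    qed (use D C assms in \<open>auto simp: prime_sets_def\<close>)
  qed
qed

text \<open>The restricted sum and its main term expand over the same choices, so they are
  subtracted termwise. The global error bound covers the terms with \<open>x / e < 1\<close> as
  well.\<close>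

lemma divisible_piltz_sum_error_le:
  assumes "(\<lambda>x. piltz_sum t x - x * poly P (ln x)) \<in> O[at_top](\<lambda>x. x powr \<kappa>)" "0 \<le> \<kappa>" "\<kappa> < 1" "2 ^ t \<le> K"
  obtains C where "C > 0" "\<And>D x. D \<in> prime_sets \<Longrightarrow> x \<ge> 1 \<Longrightarrow>
    \<bar>divisible_piltz_sum t D x - x * poly (choice_poly t P D) (ln x)\<bar> \<le>
      C * x powr \<kappa> * prime_weight K \<kappa> D"
proof -
  obtain C where C: "C > 0"
    "\<And>x. x > 0 \<Longrightarrow> \<bar>piltz_sum t x - x * poly P (ln x)\<bar> \<le> C * x powr \<kappa>"
    using piltz_error_le_powr[OF assms(1,3)] by blast
  show ?thesis
  proof (rule that[OF C(1)])
    fix D and x :: real assume D: "D \<in> prime_sets" and x: "x \<ge> 1"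
    let ?F = "\<lambda>e. piltz_sum t (x / real e) - x / real e * poly P (ln (x / real e))"
    have "x * poly (choice_poly t P D) (ln x) = (\<Sum>\<phi>\<in>prime_choices t D. choice_sign D \<phi> *
        (x / real (choice_modulus D \<phi>) * poly P (ln (x / real (choice_modulus D \<phi>)))))"
      using prime_setsD(2)[OF D] x by (intro poly_choice_poly) auto
    moreover have "divisible_piltz_sum t D x = (\<Sum>\<phi>\<in>prime_choices t D.
        choice_sign D \<phi> * piltz_sum t (x / real (choice_modulus D \<phi>)))"
      using prime_setsD[OF D] by (intro divisible_piltz_sum_choices) auto
    ultimately have "divisible_piltz_sum t D x - x * poly (choice_poly t P D) (ln x) =
        (\<Sum>\<phi>\<in>prime_choices t D. choice_sign D \<phi> * ?F (choice_modulus D \<phi>))"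
      by (simp only: sum_subtractf right_diff_distrib)
    also have "\<bar>\<dots>\<bar> \<le> C * x powr \<kappa> * prime_weight K \<kappa> D"
    proof (rule abs_choice_sum_le[where F = ?F])
      fix e :: nat assume e: "e > 0"
      have "\<bar>?F e\<bar> \<le> C * (x / real e) powr \<kappa>"
        using e x by (intro C) auto
      also have "\<dots> = C * x powr \<kappa> * real e powr - \<kappa>"
        using x by (subst divide_powr_eq) auto
      finally show "\<bar>?F e\<bar> \<le> C * x powr \<kappa> * real e powr - \<kappa>" .
    qed (use D C assms in \<open>auto simp: prime_sets_def\<close>)
    finally show "\<bar>divisible_piltz_sum t D x - x * poly (choice_poly t P D) (ln x)\<bar> \<le>
        C * x powr \<kappa> * prime_weight K \<kappa> D" .
  qed
qed

section \<open>The coprimality condition and the Euler product\<close>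

text \<open>A common prime divisor divides \<open>a\<close>, hence is at most \<open>x\<close>; so
  finitely many primes decide coprimality.\<close>

lemma Gcd_eq_1_iff_primes:
  fixes A :: "nat set"
  assumes "a \<in> A" "a > 0" "real a \<le> x"
  shows "Gcd A = 1 \<longleftrightarrow> (\<forall>p. prime p \<and> real p \<le> x \<longrightarrow> \<not> (\<forall>m\<in>A. p dvd m))"
proof
  assume "Gcd A = 1"
  then show "\<forall>p. prime p \<and> real p \<le> x \<longrightarrow> \<not> (\<forall>m\<in>A. p dvd m)"
    by (metis Gcd_greatest not_prime_unit)
next
  assume *: "\<forall>p. prime p \<and> real p \<le> x \<longrightarrow> \<not> (\<forall>m\<in>A. p dvd m)"
  show "Gcd A = 1"
  proof (rule ccontr)
    assume "Gcd A \<noteq> 1"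
    then obtain p where p: "prime p" "p dvd Gcd A" using prime_factor_nat by blast
    then have dvd: "p dvd m" if "m \<in> A" for m using that by (meson Gcd_dvd dvd_trans)
    then have "p \<le> a" using assms by (intro dvd_imp_le) auto
    then have "real p \<le> x" using assms(3) by linarith
    with * p(1) dvd show False by blast
  qed
qed

lemma divisible_piltz_sum_eq_0:
  assumes "p \<in> D" "real p > x"
  shows "divisible_piltz_sum t D x = 0"
proof -
  have "{n. 1 \<le> n \<and> real n \<le> x \<and> (\<forall>p\<in>D. p dvd n)} = {}"
    using assms by (fastforce dest: dvd_imp_le)
  then show ?thesis by (simp only: divisible_piltz_sum_def sum.empty)
qed

text \<open>The coprimality indicator is a product over the primes up to \<open>x\<close>, expanded
  over their subsets. A set \<open>D\<close> with a larger prime contributes 0, so the finite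
  identity can be stated over all of \<open>prime_sets\<close>, the index set of the main
  term.\<close>

lemma coprime_sum_has_sum:
  assumes "r \<ge> 1"
  shows "((\<lambda>D. (-1) ^ card D * (\<Prod>i=1..r. divisible_piltz_sum (t i) D x)) has_sum
    (\<Sum>n\<in>coprime_tuples r x. \<Prod>i=1..r. real (piltz (t i) (n i)))) prime_sets"
proof (rule has_sum_finite_neutralI)
  define A where "A = {p::nat. prime p \<and> real p \<le> x}"
  define B where "B = {m::nat. 1 \<le> m \<and> real m \<le> x}"
  have finB: "finite B" by (simp add: B_def)
  have "A \<subseteq> B" by (auto simp: A_def B_def Suc_le_eq prime_gt_0_nat)
  then have "finite A" using finB finite_subset by auto
  then have prod_not: "(\<Prod>p\<in>A. 1 - of_bool (b p)) = (of_bool (\<forall>p\<in>A. \<not> b p) :: real)" for b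
    by (induction A rule: finite_induct) auto
  show finA: "finite (Pow A)" using \<open>finite A\<close> by simp
  show "Pow A \<subseteq> prime_sets"
    using finA by (auto simp: prime_sets_def A_def intro: finite_subset)
  show "(-1) ^ card D * (\<Prod>i=1..r. divisible_piltz_sum (t i) D x) = 0" if "D \<in> prime_sets - Pow A" for D
  proof -
    obtain p where p: "p \<in> D" "real p > x"
      using \<open>D \<in> _\<close> by (force simp: A_def prime_sets_def)
    then have "divisible_piltz_sum (t i) D x = 0" for i by (rule divisible_piltz_sum_eq_0)
    then show ?thesis using assms by simp
  qed
  have gcd: "of_bool (Gcd (n ` {1..r}) = 1) =
      (\<Sum>D\<in>Pow A. (-1) ^ card D * (\<Prod>i=1..r. of_bool (\<forall>p\<in>D. p dvd n i)) :: real)"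
    if n: "n \<in> {1..r} \<rightarrow>\<^sub>E B" for n
  proof -
    have "n 1 \<in> B" using n assms by (auto simp: PiE_iff)
    then have "Gcd (n ` {1..r}) = 1 \<longleftrightarrow> (\<forall>p\<in>A. \<not> (\<forall>i\<in>{1..r}. p dvd n i))"
      using Gcd_eq_1_iff_primes[of "n 1" "n ` {1..r}" x] assms by (auto simp: A_def B_def)
    then have "of_bool (Gcd (n ` {1..r}) = 1) = (\<Prod>p\<in>A. 1 - of_bool (\<forall>i\<in>{1..r}. p dvd n i) :: real)"
      by (simp only: prod_not)
    also have "\<dots> = (\<Sum>D\<in>Pow A. (-1) ^ card D * (\<Prod>p\<in>D. of_bool (\<forall>i\<in>{1..r}. p dvd n i)))"
      using finA by (subst prod_diff_conv_sum) auto
    also have "\<dots> = (\<Sum>D\<in>Pow A. (-1) ^ card D * (\<Prod>i=1..r. of_bool (\<forall>p\<in>D. p dvd n i)))"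
    proof (intro sum.cong arg_cong2[where f = times] refl)
      fix D assume "D \<in> Pow A"
      then have "finite D" using finA finite_subset by auto
      then show "(\<Prod>p\<in>D. of_bool (\<forall>i\<in>{1..r}. p dvd n i) :: real) = (\<Prod>i=1..r. of_bool (\<forall>p\<in>D. p dvd n i))"
        by (auto simp: prod_of_bool_eq simp del: of_bool_eq_iff intro!: arg_cong[where f = of_bool])
    qed
    finally show ?thesis .
  qed
  have "(\<Sum>n\<in>coprime_tuples r x. \<Prod>i=1..r. real (piltz (t i) (n i))) =
      (\<Sum>n\<in>{1..r} \<rightarrow>\<^sub>E B. (\<Prod>i=1..r. real (piltz (t i) (n i))) * of_bool (Gcd (n ` {1..r}) = 1))"
    unfolding coprime_tuples_def
    by (rule sum.mono_neutral_cong_left) (use finB in \<open>auto simp: B_def intro!: finite_PiE\<close>)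
  also have "\<dots> = (\<Sum>n\<in>{1..r} \<rightarrow>\<^sub>E B. \<Sum>D\<in>Pow A.
      (-1) ^ card D * (\<Prod>i=1..r. real (piltz (t i) (n i)) * of_bool (\<forall>p\<in>D. p dvd n i)))"
    by (intro sum.cong refl) (simp only: gcd sum_distrib_left prod.distrib mult_ac)
  also have "\<dots> = (\<Sum>D\<in>Pow A. (-1) ^ card D * (\<Sum>n\<in>{1..r} \<rightarrow>\<^sub>E B.
      \<Prod>i=1..r. real (piltz (t i) (n i)) * of_bool (\<forall>p\<in>D. p dvd n i)))"
    unfolding sum_distrib_left by (rule sum.swap)
  also have "\<dots> = (\<Sum>D\<in>Pow A. (-1) ^ card D * (\<Prod>i=1..r. divisible_piltz_sum (t i) D x))"
  proof (intro sum.cong arg_cong2[where f = times] refl)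
    fix D
    have "(\<Sum>n\<in>{1..r} \<rightarrow>\<^sub>E B. \<Prod>i=1..r. real (piltz (t i) (n i)) * of_bool (\<forall>p\<in>D. p dvd n i)) =
        (\<Prod>i=1..r. \<Sum>m\<in>B. real (piltz (t i) m) * of_bool (\<forall>p\<in>D. p dvd m))"
      using finB by (subst prod_sum_PiE) auto
    also have "\<dots> = (\<Prod>i=1..r. divisible_piltz_sum (t i) D x)"
      unfolding divisible_piltz_sum_def
      by (intro prod.cong refl sum.mono_neutral_cong_right) (use finB in \<open>auto simp: B_def\<close>)
    finally show "(\<Sum>n\<in>{1..r} \<rightarrow>\<^sub>E B. \<Prod>i=1..r. real (piltz (t i) (n i)) * of_bool (\<forall>p\<in>D. p dvd n i)) =
        (\<Prod>i=1..r. divisible_piltz_sum (t i) D x)" .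
  qed
  finally show "(\<Sum>n\<in>coprime_tuples r x. \<Prod>i=1..r. real (piltz (t i) (n i))) =
      (\<Sum>D\<in>Pow A. (-1) ^ card D * (\<Prod>i=1..r. divisible_piltz_sum (t i) D x))" .
qed

text \<open>Heuristically, the proportion of entry tuples, weighted by the divisor functions, in
  which \<open>p\<close> divides every entry.\<close>

definition common_density :: "nat \<Rightarrow> (nat \<Rightarrow> nat) \<Rightarrow> nat \<Rightarrow> real" where
  "common_density r t p = (\<Prod>i=1..r. 1 - (1 - 1 / real p) ^ t i)"

text \<open>The sum over \<open>a\<close> factors over \<open>i\<close> into binomial sums, and the
  \<open>r\<close> resulting minus signs combine with \<open>(-1) ^ (r - 1)\<close> to a single
  one.\<close>

lemma Delta_factor_eq:
  assumes "r \<ge> 1"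
  shows "Delta_factor r t p = 1 - common_density r t p"
proof -
  define T where "T = Max (t ` {1..r})"
  have "(\<Sum>a \<in> {1..r} \<rightarrow>\<^sub>E {1..T}.
      1 / real p ^ (\<Sum>i=1..r. a i) * (\<Prod>i=1..r. (-1) ^ a i * real (t i choose a i))) =
      (\<Sum>a \<in> {1..r} \<rightarrow>\<^sub>E {1..T}. \<Prod>i=1..r. real (t i choose a i) * (- (1 / real p)) ^ a i)"
  proof (intro sum.cong refl)
    fix a :: "nat \<Rightarrow> nat"
    have "1 / real p ^ (\<Sum>i=1..r. a i) = (\<Prod>i=1..r. (1 / real p) ^ a i)"
      by (simp add: power_sum power_divide prod_dividef)
    moreover have "(- (1 / real p)) ^ k = (-1) ^ k * (1 / real p) ^ k" for k
      by (metis mult_minus1 power_mult_distrib)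
    ultimately show "1 / real p ^ (\<Sum>i=1..r. a i) * (\<Prod>i=1..r. (-1) ^ a i * real (t i choose a i)) =
        (\<Prod>i=1..r. real (t i choose a i) * (- (1 / real p)) ^ a i)"
      by (simp only: prod.distrib mult_ac)
  qed
  also have "\<dots> = (\<Prod>i=1..r. \<Sum>k=1..T. real (t i choose k) * (- (1 / real p)) ^ k)"
    by (subst prod_sum_PiE) auto
  also have "\<dots> = (\<Prod>i=1..r. - (1 - (1 - 1 / real p) ^ t i))"
  proof (intro prod.cong refl)
    fix i assume i: "i \<in> {1..r}"
    then have "t i \<le> T" by (simp add: T_def)
    have "(1 - 1 / real p) ^ t i = (\<Sum>k\<le>t i. real (t i choose k) * (- (1 / real p)) ^ k)"
      using binomial_ring[of "- (1 / real p)" 1 "t i"] by simp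
    also have "\<dots> = (\<Sum>k\<le>T. real (t i choose k) * (- (1 / real p)) ^ k)"
      using \<open>t i \<le> T\<close> by (intro sum.mono_neutral_left) (auto simp: binomial_eq_0)
    \<comment> \<open>The exponents \<open>a i\<close> start at 1, so the term \<open>k = 0\<close>,
      equal to 1, has to be split off.\<close>
    also have "{..T} = insert 0 {1..T}" by auto
    finally show "(\<Sum>k=1..T. real (t i choose k) * (- (1 / real p)) ^ k) = - (1 - (1 - 1 / real p) ^ t i)"
      by simp
  qed
  also have "\<dots> = (-1) ^ r * common_density r t p"
    by (simp only: prod_uminus common_density_def card_atLeastAtMost) simp
  finally have "Delta_factor r t p = 1 + (-1) ^ (r - 1) * ((-1) ^ r * common_density r t p)"
    unfolding Delta_factor_def T_def by simp
  also have "(-1) ^ (r - 1) * ((-1) ^ r * common_density r t p) = - common_density r t p"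
    using assms by (cases r) auto
  finally show ?thesis by simp
qed

text \<open>Bernoulli's inequality gives \<open>t i / p\<close> for each factor, and two factors
  already give the summable \<open>p powr - 2\<close>. A single factor is below 1, which keeps every
  Euler factor positive.\<close>

lemma common_density_bounds:
  assumes "prime p" "r \<ge> 2"
  shows "0 \<le> common_density r t p" "common_density r t p < 1"
    "common_density r t p \<le> (\<Prod>i=1..r. real (t i)) * real p powr - 2"
proof -
  have p: "real p \<ge> 2" using prime_ge_2_nat[OF assms(1)] by simp
  have x: "0 < 1 - 1 / real p" "1 - 1 / real p \<le> 1" using p by (auto simp: field_simps)
  have f: "0 \<le> 1 - (1 - 1 / real p) ^ n" "1 - (1 - 1 / real p) ^ n < 1"
    "1 - (1 - 1 / real p) ^ n \<le> real n * (1 / real p)" for n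
    using x Bernoulli_inequality[of "- (1 / real p)" n] p by (auto simp: power_le_one)
  show "0 \<le> common_density r t p"
    unfolding common_density_def using f by (intro prod_nonneg) auto
  have "common_density r t p \<le> (\<Prod>i\<in>{1}. 1 - (1 - 1 / real p) ^ t i)"
  proof -
    have "common_density r t p = (1 - (1 - 1 / real p) ^ t 1) * (\<Prod>i\<in>{1..r}-{1}. 1 - (1 - 1 / real p) ^ t i)"
      unfolding common_density_def using assms(2) by (intro prod.remove) auto
    also have "\<dots> \<le> (1 - (1 - 1 / real p) ^ t 1) * 1"
      using f(1,2) by (intro mult_left_mono prod_le_1) (auto intro: less_imp_le)
    finally show ?thesis by simp
  qed
  also have "\<dots> < 1" using f(2) by simp
  finally show "common_density r t p < 1" .
  have "common_density r t p \<le> (\<Prod>i=1..r. real (t i) * (1 / real p))"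
    unfolding common_density_def using f by (intro prod_mono) auto
  also have "\<dots> = (\<Prod>i=1..r. real (t i)) * (1 / real p) ^ r"
    by (simp add: prod.distrib power_divide prod_dividef)
  also have "\<dots> \<le> (\<Prod>i=1..r. real (t i)) * (1 / real p) ^ 2"
    using p assms(2) by (intro mult_left_mono power_decreasing prod_nonneg) auto
  also have "(1 / real p) ^ 2 = real p powr - 2"
    using p by (simp add: powr_minus powr_realpow power_divide divide_inverse power_inverse)
  finally show "common_density r t p \<le> (\<Prod>i=1..r. real (t i)) * real p powr - 2" .
qed

lemma Delta_term_eq:
  "r \<ge> 1 \<Longrightarrow> Delta_term r t p = (if prime p then 1 - common_density r t p else 1)"
  by (simp add: Delta_term_def Delta_factor_eq)

lemma summable_prod_powr_minus_2: "summable (\<lambda>p. (\<Prod>i=1..r. real (t i)) * real p powr - 2)"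
  by (intro summable_mult) (simp add: summable_real_powr_iff)

lemma convergent_prod_Delta:
  assumes "r \<ge> 2"
  shows "convergent_prod (Delta_term r t)"
proof (rule abs_convergent_prod_imp_convergent_prod, rule summable_imp_abs_convergent_prod)
  show "summable (\<lambda>p. norm (Delta_term r t p - 1))"
  proof (rule summable_comparison_test'[OF summable_prod_powr_minus_2[of t r]])
    fix p :: nat
    have "0 \<le> (\<Prod>i=1..r. real (t i)) * real p powr - 2"
      by (intro mult_nonneg_nonneg prod_nonneg) auto
    then show "norm (norm (Delta_term r t p - 1)) \<le> (\<Prod>i=1..r. real (t i)) * real p powr - 2"
      using common_density_bounds[OF _ assms, of p t] assms by (simp add: Delta_term_eq)
  qed
qed

text \<open>This secures the exact degree of the main polynomial.\<close>

lemma Delta_nonzero: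
  assumes "r \<ge> 2"
  shows "Delta r t \<noteq> 0"
  unfolding Delta_def
proof (rule prodinf_nonzero[OF convergent_prod_Delta[OF assms]])
  show "Delta_term r t p \<noteq> 0" for p
    using common_density_bounds(2)[OF _ assms, of p t] assms by (auto simp: Delta_term_eq)
qed

lemma Delta_has_sum:
  assumes "r \<ge> 2"
  shows "((\<lambda>D. (-1) ^ card D * (\<Prod>p\<in>D. common_density r t p)) has_sum Delta r t) prime_sets"
proof (rule has_sum_prime_sets_prod[OF summable_prod_powr_minus_2[of t r]])
  show "(\<lambda>N. \<Prod>p\<le>N. if prime p then 1 - common_density r t p else 1) \<longlonglongrightarrow> Delta r t"
    using convergent_prod_LIMSEQ[OF convergent_prod_Delta[OF assms, of t]] assms
    unfolding Delta_def by (simp add: Delta_term_eq)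
  show "\<bar>common_density r t p\<bar> \<le> (\<Prod>i=1..r. real (t i)) * real p powr - 2" if "prime p" for p
    using common_density_bounds[OF that assms, of t] by simp
  show "0 \<le> (\<Prod>i=1..r. real (t i)) * real p powr - 2" for p
    by (intro mult_nonneg_nonneg prod_nonneg) auto
qed

section \<open>Comparison of sums and uniform constants\<close>

lemma has_sum_finite_sum:
  fixes f :: "'i \<Rightarrow> 'a \<Rightarrow> 'b::topological_comm_monoid_add"
  assumes "finite I" "\<And>i. i \<in> I \<Longrightarrow> (f i has_sum s i) A"
  shows "((\<lambda>x. \<Sum>i\<in>I. f i x) has_sum (\<Sum>i\<in>I. s i)) A"
  using assms by (induction I rule: finite_induct) (simp_all add: has_sum_add)

lemma abs_has_sum_le:
  fixes f g :: "'a \<Rightarrow> real"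
  assumes "(f has_sum s) A" "(g has_sum u) A" "\<And>x. x \<in> A \<Longrightarrow> \<bar>f x\<bar> \<le> g x"
  shows "\<bar>s\<bar> \<le> u"
proof -
  have "s \<le> u" using assms by (intro has_sum_mono[OF assms(1,2)]) (auto simp: abs_le_iff)
  moreover have "- s \<le> u"
    using assms(3) by (intro has_sum_mono[OF has_sum_uminusI[OF assms(1)] assms(2)]) (auto simp: abs_le_iff)
  ultimately show ?thesis by simp
qed

text \<open>Constants found separately for each \<open>i\<close> are merged by \<open>max\<close>.
  The set \<open>S\<close> will consist of pairs such as \<open>(D, x)\<close>, so that the merged
  constant is uniform in both.\<close>

lemma uniform_const:
  fixes f :: "'i \<Rightarrow> 'z \<Rightarrow> real"
  assumes "finite I" "\<And>i. i \<in> I \<Longrightarrow> \<exists>C>0. \<forall>z\<in>S. f i z \<le> C * g z" "\<And>z. z \<in> S \<Longrightarrow> g z \<ge> 0"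
  shows "\<exists>C>0. \<forall>i\<in>I. \<forall>z\<in>S. f i z \<le> C * g z"
  using assms(1,2)
proof (induction I rule: finite_induct)
  case empty
  then show ?case by (intro exI[of _ 1]) auto
next
  case (insert i I)
  then obtain C C' where C: "C > 0" "\<forall>i\<in>I. \<forall>z\<in>S. f i z \<le> C * g z"
    "C' > 0" "\<forall>z\<in>S. f i z \<le> C' * g z"
    by (metis insertCI)
  have "C * g z \<le> max C C' * g z" "C' * g z \<le> max C C' * g z" if "z \<in> S" for z
    using assms(3)[OF that] by (auto intro: mult_right_mono)
  with C show ?case
    by (intro exI[of _ "max C C'"]) (fastforce intro: order_trans)
qed

section \<open>The main term and the error term\<close>

text \<open>
  Expanding a product of local main terms \<open>x P\<^sub>i\<^sub>,\<^sub>D(ln x)\<close> and summing over \<open>D\<close> coefficientwise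
  gives the polynomial of the theorem.
\<close>

definition choice_prod :: "nat \<Rightarrow> (nat \<Rightarrow> nat) \<Rightarrow> (nat \<Rightarrow> real poly) \<Rightarrow> nat set \<Rightarrow> real poly" where
  "choice_prod r t P D = (\<Prod>i=1..r. choice_poly (t i) (P i) D)"

definition main_coeff :: "nat \<Rightarrow> (nat \<Rightarrow> nat) \<Rightarrow> (nat \<Rightarrow> real poly) \<Rightarrow> nat \<Rightarrow> real" where
  "main_coeff r t P j = (\<Sum>\<^sub>\<infinity>D\<in>prime_sets. (-1) ^ card D * coeff (choice_prod r t P D) j)"

definition main_poly :: "nat \<Rightarrow> (nat \<Rightarrow> nat) \<Rightarrow> (nat \<Rightarrow> real poly) \<Rightarrow> real poly" where
  "main_poly r t P = (\<Sum>j\<le>(\<Sum>i=1..r. degree (P i)). monom (main_coeff r t P j) j)"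

text \<open>Swapping the products over \<open>i\<close> and over \<open>p\<close> collects the local
  densities of the factors into \<open>common_density\<close>.\<close>

lemma choice_prod_degree:
  assumes "D \<in> prime_sets"
  shows "degree (choice_prod r t P D) \<le> (\<Sum>i=1..r. degree (P i))"
    "coeff (choice_prod r t P D) (\<Sum>i=1..r. degree (P i)) =
      (\<Prod>i=1..r. lead_coeff (P i)) * (\<Prod>p\<in>D. common_density r t p)"
proof -
  have deg: "degree (choice_poly (t i) (P i) D) \<le> degree (P i)" for i
    using assms by (intro degree_choice_poly prime_setsD)
  note * = coeff_prod_sum_degrees[of "{1..r}" "\<lambda>i. choice_poly (t i) (P i) D" "\<lambda>i. degree (P i)"]
  show "degree (choice_prod r t P D) \<le> (\<Sum>i=1..r. degree (P i))"
    using * deg by (simp add: choice_prod_def)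
  have "coeff (choice_prod r t P D) (\<Sum>i=1..r. degree (P i)) =
      (\<Prod>i=1..r. lead_coeff (P i) * (\<Prod>p\<in>D. 1 - (1 - 1 / real p) ^ t i))"
    using * deg coeff_degree_choice_poly[OF prime_setsD(1)[OF assms]] by (simp add: choice_prod_def)
  also have "\<dots> = (\<Prod>i=1..r. lead_coeff (P i)) * (\<Prod>p\<in>D. common_density r t p)"
    unfolding prod.distrib common_density_def by (subst prod.swap) (rule refl)
  finally show "coeff (choice_prod r t P D) (\<Sum>i=1..r. degree (P i)) =
      (\<Prod>i=1..r. lead_coeff (P i)) * (\<Prod>p\<in>D. common_density r t p)" .
qed

lemma two_power_le_sum:
  fixes t :: "nat \<Rightarrow> nat"
  assumes "i \<in> {1..r}"
  shows "(2::real) ^ t i \<le> 2 ^ (\<Sum>i=1..r. t i)"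
  using assms by (intro power_increasing member_le_sum) auto

text \<open>An infinite sum that fails to converge is 0 by convention, so convergence has to be
  proved: the product of \<open>r\<close> local polynomials has weight exponent
  \<open>3 * r / 4\<close>, which is at least 3/2.\<close>

lemma main_coeff_has_sum:
  assumes "r \<ge> 2"
  shows "((\<lambda>D. (-1) ^ card D * coeff (choice_prod r t P D) j) has_sum main_coeff r t P j) prime_sets"
proof -
  define K :: real where "K = 2 ^ (\<Sum>i=1..r. t i)"
  define n where "n = (\<Sum>i=1..r. degree (P i))"
  have K: "K > 0" by (simp add: K_def)
  have "\<exists>C>0. \<forall>i\<in>{1..r}. \<forall>z\<in>prime_sets \<times> UNIV.
      \<bar>coeff (choice_poly (t i) (P i) (fst z)) (snd z)\<bar> \<le> C * prime_weight K (1 - 1 / 4) (fst z)"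
  proof (rule uniform_const)
    fix i assume "i \<in> {1..r}"
    then have "2 ^ t i \<le> K" unfolding K_def by (rule two_power_le_sum)
    then obtain C where "C > 0" "\<And>D j. D \<in> prime_sets \<Longrightarrow>
        \<bar>coeff (choice_poly (t i) (P i) D) j\<bar> \<le> C * prime_weight K (1 - 1 / 4) D"
      using coeff_choice_poly_le[where \<delta> = "1 / 4" and t = "t i" and P = "P i" and K = K] by auto
    then show "\<exists>C>0. \<forall>z\<in>prime_sets \<times> UNIV.
        \<bar>coeff (choice_poly (t i) (P i) (fst z)) (snd z)\<bar> \<le> C * prime_weight K (1 - 1 / 4) (fst z)"
      by (intro exI[of _ C]) auto
  qed (use K in \<open>auto intro!: less_imp_le prime_weight_pos dest: prime_setsD\<close>)
  then obtain C where C: "C > 0" "\<And>i D j. i \<in> {1..r} \<Longrightarrow> D \<in> prime_sets \<Longrightarrow>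
      \<bar>coeff (choice_poly (t i) (P i) D) j\<bar> \<le> C * prime_weight K (1 - 1 / 4) D"
    by force
  have summable: "(\<lambda>D. (real (n + 1) * C) ^ r * prime_weight (K ^ r) (real r * (1 - 1 / 4)) D) summable_on prime_sets"
    using assms K by (intro summable_on_cmult_right prime_weight_summable) auto
  have "(\<lambda>D. (-1) ^ card D * coeff (choice_prod r t P D) j) summable_on prime_sets"
  proof (rule abs_summable_summable[OF Infinite_Sum.abs_summable_on_comparison_test'[OF summable]])
    fix D assume D: "D \<in> prime_sets"
    have "\<bar>coeff (choice_prod r t P D) j\<bar> \<le> (real (n + 1) * (C * prime_weight K (1 - 1 / 4) D)) ^ card {1..r}"
      unfolding choice_prod_def
    proof (rule abs_coeff_prod_le)
      fix i assume i: "i \<in> {1..r}"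
      have "degree (P i) \<le> n" unfolding n_def using i by (intro member_le_sum) auto
      then show "degree (choice_poly (t i) (P i) D) \<le> n"
        using degree_choice_poly[OF prime_setsD(1)[OF D]] order_trans by blast
      show "\<bar>coeff (choice_poly (t i) (P i) D) j\<bar> \<le> C * prime_weight K (1 - 1 / 4) D" for j
        by (rule C(2)[OF i D])
    qed (use C(1) K prime_setsD(2)[OF D] in \<open>auto intro!: mult_nonneg_nonneg less_imp_le[OF prime_weight_pos]\<close>)
    also have "\<dots> = (real (n + 1) * C) ^ r * prime_weight K (1 - 1 / 4) D ^ r"
      by (simp add: power_mult_distrib mult_ac)
    also have "prime_weight K (1 - 1 / 4) D ^ r = prime_weight (K ^ r) (real r * (1 - 1 / 4)) D"
      using prime_setsD(2)[OF D] by (rule prime_weight_power)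
    finally show "norm ((-1) ^ card D * coeff (choice_prod r t P D) j) \<le>
        (real (n + 1) * C) ^ r * prime_weight (K ^ r) (real r * (1 - 1 / 4)) D"
      by (simp add: abs_mult power_abs)
  qed
  then show ?thesis
    unfolding main_coeff_def by (rule has_sum_infsum)
qed

text \<open>The degree bound is the same for all \<open>D\<close>, so the sum over \<open>D\<close>
  only has to be exchanged with a finite sum over coefficients.\<close>

lemma main_poly_has_sum:
  assumes "r \<ge> 2"
  shows "((\<lambda>D. (-1) ^ card D * (\<Prod>i=1..r. x * poly (choice_poly (t i) (P i) D) u)) has_sum
    x ^ r * poly (main_poly r t P) u) prime_sets"
proof -
  define N where "N = (\<Sum>i=1..r. degree (P i))"
  have sum: "((\<lambda>D. x ^ r * (\<Sum>j\<le>N. (-1) ^ card D * coeff (choice_prod r t P D) j * u ^ j)) has_sum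
      x ^ r * (\<Sum>j\<le>N. main_coeff r t P j * u ^ j)) prime_sets"
    by (intro has_sum_cmult_right has_sum_finite_sum has_sum_cmult_left main_coeff_has_sum assms) simp
  have poly: "(\<Sum>j\<le>N. main_coeff r t P j * u ^ j) = poly (main_poly r t P) u"
    by (simp add: main_poly_def N_def poly_sum poly_monom)
  have summand: "x ^ r * (\<Sum>j\<le>N. (-1) ^ card D * coeff (choice_prod r t P D) j * u ^ j) =
      (-1) ^ card D * (\<Prod>i=1..r. x * poly (choice_poly (t i) (P i) D) u)" if D: "D \<in> prime_sets" for D
  proof -
    have "(\<Sum>j\<le>N. coeff (choice_prod r t P D) j * u ^ j) = poly (choice_prod r t P D) u"
      unfolding poly_altdef N_def
      by (rule sum.mono_neutral_right) (use choice_prod_degree(1)[OF D, where r = r and t = t and P = P] in \<open>auto simp: coeff_eq_0\<close>)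
    then have "(\<Sum>j\<le>N. (-1) ^ card D * coeff (choice_prod r t P D) j * u ^ j) =
        (-1) ^ card D * poly (choice_prod r t P D) u"
      by (simp add: sum_distrib_left mult.assoc flip: sum_distrib_left)
    then show ?thesis
      by (simp add: choice_prod_def poly_prod prod.distrib)
  qed
  show ?thesis
    using sum unfolding poly by (subst (asm) has_sum_cong[OF summand])
qed

text \<open>Replacing the restricted sums by their main terms leaves, for each \<open>D\<close>, one
  error factor and \<open>r - 1\<close> full factors. The assumption \<open>gap\<close> says that
  the weight exponent of this product exceeds 1, so the errors can be summed over all
  \<open>D\<close>.\<close>

lemma coprime_sum_error:
  assumes r: "r \<ge> 2" and \<kappa>: "0 \<le> \<kappa>" "\<kappa> < 1" and \<delta>: "0 < \<delta>" "\<delta> < 1"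
    and gap: "(real r - 1) * (1 - \<delta>) + \<kappa> > 1"
    and error: "\<And>i. i \<in> {1..r} \<Longrightarrow>
      (\<lambda>x. piltz_sum (t i) x - x * poly (P i) (ln x)) \<in> O[at_top](\<lambda>x. x powr \<kappa>)"
  shows "\<exists>C. \<forall>x\<ge>1. \<bar>(\<Sum>n\<in>coprime_tuples r x. \<Prod>i=1..r. real (piltz (t i) (n i)))
      - x ^ r * poly (main_poly r t P) (ln x)\<bar> \<le> C * x powr ((real r - 1) * (1 + \<delta>) + \<kappa>)"
proof -
  define K :: real where "K = 2 ^ (\<Sum>i=1..r. t i)"
  have K: "K > 0" by (simp add: K_def)
  have K_ge: "2 ^ t i \<le> K" if "i \<in> {1..r}" for i
    using that unfolding K_def by (rule two_power_le_sum)
  define S where "S = prime_sets \<times> {1::real..}"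
  let ?T = "\<lambda>i z. divisible_piltz_sum (t i) (fst z) (snd z)"
  let ?M = "\<lambda>i z. snd z * poly (choice_poly (t i) (P i) (fst z)) (ln (snd z))"
  let ?g = "\<lambda>z. snd z powr (1 + \<delta>) * prime_weight K (1 - \<delta>) (fst z)"
  let ?h = "\<lambda>z. snd z powr \<kappa> * prime_weight K \<kappa> (fst z)"
  have pos: "?g z > 0" "?h z > 0" if "z \<in> S" for z
    using that K by (auto simp: S_def intro!: mult_pos_pos prime_weight_pos dest: prime_setsD)
  have "\<exists>C>0. \<forall>i\<in>{1..r}. \<forall>z\<in>S. \<bar>?T i z\<bar> \<le> C * ?g z"
  proof (rule uniform_const)
    fix i assume "i \<in> {1..r}"
    then obtain C where "C > 0" "\<And>D x. D \<in> prime_sets \<Longrightarrow> x \<ge> 1 \<Longrightarrow>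
        \<bar>divisible_piltz_sum (t i) D x\<bar> \<le> C * x powr (1 + \<delta>) * prime_weight K (1 - \<delta>) D"
      using divisible_piltz_sum_le[OF \<delta> K_ge] by blast
    then show "\<exists>C>0. \<forall>z\<in>S. \<bar>?T i z\<bar> \<le> C * ?g z"
      by (intro exI[of _ C]) (auto simp: S_def mult.assoc)
  qed (use pos in \<open>auto intro: less_imp_le\<close>)
  then obtain C1 where C1: "C1 > 0" "\<And>i z. i \<in> {1..r} \<Longrightarrow> z \<in> S \<Longrightarrow> \<bar>?T i z\<bar> \<le> C1 * ?g z"
    by blast
  have "\<exists>C>0. \<forall>i\<in>{1..r}. \<forall>z\<in>S. \<bar>?M i z\<bar> \<le> C * ?g z"
  proof (rule uniform_const)
    fix i assume "i \<in> {1..r}"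
    then obtain C where "C > 0" "\<And>D x. D \<in> prime_sets \<Longrightarrow> x \<ge> 1 \<Longrightarrow>
        \<bar>x * poly (choice_poly (t i) (P i) D) (ln x)\<bar> \<le> C * x powr (1 + \<delta>) * prime_weight K (1 - \<delta>) D"
      using poly_choice_poly_le[OF \<delta> K_ge] by blast
    then show "\<exists>C>0. \<forall>z\<in>S. \<bar>?M i z\<bar> \<le> C * ?g z"
      by (intro exI[of _ C]) (auto simp: S_def mult.assoc)
  qed (use pos in \<open>auto intro: less_imp_le\<close>)
  then obtain C2 where C2: "C2 > 0" "\<And>i z. i \<in> {1..r} \<Longrightarrow> z \<in> S \<Longrightarrow> \<bar>?M i z\<bar> \<le> C2 * ?g z"
    by blast
  have "\<exists>C>0. \<forall>i\<in>{1..r}. \<forall>z\<in>S. \<bar>?T i z - ?M i z\<bar> \<le> C * ?h z"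
  proof (rule uniform_const)
    fix i assume i: "i \<in> {1..r}"
    obtain C where "C > 0" "\<And>D x. D \<in> prime_sets \<Longrightarrow> x \<ge> 1 \<Longrightarrow>
        \<bar>divisible_piltz_sum (t i) D x - x * poly (choice_poly (t i) (P i) D) (ln x)\<bar> \<le>
          C * x powr \<kappa> * prime_weight K \<kappa> D"
      using divisible_piltz_sum_error_le[OF error[OF i] \<kappa> K_ge[OF i]] by blast
    then show "\<exists>C>0. \<forall>z\<in>S. \<bar>?T i z - ?M i z\<bar> \<le> C * ?h z"
      by (intro exI[of _ C]) (auto simp: S_def mult.assoc)
  qed (use pos in \<open>auto intro: less_imp_le\<close>)
  then obtain C3 where C3: "C3 > 0" "\<And>i z. i \<in> {1..r} \<Longrightarrow> z \<in> S \<Longrightarrow> \<bar>?T i z - ?M i z\<bar> \<le> C3 * ?h z"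
    by blast
  \<comment> \<open>The comparison of two products asks for one bound on the factors of
    both.\<close>
  define A where "A = max C1 C2"
  have A: "A > 0" using C1(1) by (simp add: A_def)
  define \<sigma> where "\<sigma> = (real r - 1) * (1 - \<delta>) + \<kappa>"
  define G where "G = infsum (prime_weight (K ^ r) \<sigma>) prime_sets"
  have G: "(prime_weight (K ^ r) \<sigma> has_sum G) prime_sets"
    unfolding G_def using gap K by (intro has_sum_infsum prime_weight_summable) (auto simp: \<sigma>_def)
  have "\<bar>(\<Sum>n\<in>coprime_tuples r x. \<Prod>i=1..r. real (piltz (t i) (n i)))
      - x ^ r * poly (main_poly r t P) (ln x)\<bar> \<le>
      (real r * C3 * A ^ (r - 1) * x powr ((real r - 1) * (1 + \<delta>) + \<kappa>)) * G" if x: "x \<ge> 1" for x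
  proof (rule abs_has_sum_le)
    let ?d = "\<lambda>D. (-1) ^ card D * (\<Prod>i=1..r. ?T i (D, x)) - (-1) ^ card D * (\<Prod>i=1..r. ?M i (D, x))"
    have "((\<lambda>D. (-1) ^ card D * (\<Prod>i=1..r. ?T i (D, x)) + - ((-1) ^ card D * (\<Prod>i=1..r. ?M i (D, x)))) has_sum
        ((\<Sum>n\<in>coprime_tuples r x. \<Prod>i=1..r. real (piltz (t i) (n i)))
          + - (x ^ r * poly (main_poly r t P) (ln x)))) prime_sets"
      unfolding fst_conv snd_conv using r
      by (intro has_sum_add has_sum_uminusI coprime_sum_has_sum main_poly_has_sum) auto
    then show "(?d has_sum ((\<Sum>n\<in>coprime_tuples r x. \<Prod>i=1..r. real (piltz (t i) (n i)))
          - x ^ r * poly (main_poly r t P) (ln x))) prime_sets"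
      by simp
    show "((\<lambda>D. (real r * C3 * A ^ (r - 1) * x powr ((real r - 1) * (1 + \<delta>) + \<kappa>)) *
        prime_weight (K ^ r) \<sigma> D) has_sum
        (real r * C3 * A ^ (r - 1) * x powr ((real r - 1) * (1 + \<delta>) + \<kappa>)) * G) prime_sets"
      by (intro has_sum_cmult_right G)
    fix D assume D: "D \<in> prime_sets"
    then have z: "(D, x) \<in> S" using x by (simp add: S_def)
    have g: "C1 * ?g (D, x) \<le> A * ?g (D, x)" "C2 * ?g (D, x) \<le> A * ?g (D, x)"
      by (intro mult_right_mono less_imp_le[OF pos(1)[OF z]]; simp add: A_def)+
    have "\<bar>?d D\<bar> = \<bar>(\<Prod>i=1..r. ?T i (D, x)) - (\<Prod>i=1..r. ?M i (D, x))\<bar>"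
      by (simp add: abs_mult power_abs flip: right_diff_distrib)
    also have "\<dots> \<le> real (card {1..r}) * (C3 * ?h (D, x)) * (A * ?g (D, x)) ^ (card {1..r} - 1)"
    proof (rule abs_prod_diff_le)
      show "0 < A * ?g (D, x)" using A pos(1)[OF z] by (rule mult_pos_pos)
    qed (use order_trans[OF C1(2)[OF _ z] g(1)] order_trans[OF C2(2)[OF _ z] g(2)] C3(2)[OF _ z] in simp_all)
    also have "\<dots> = real r * C3 * A ^ (r - 1) * (x powr \<kappa> * (x powr (1 + \<delta>)) ^ (r - 1)) *
        (prime_weight K \<kappa> D * prime_weight K (1 - \<delta>) D ^ (r - 1))"
      by (simp add: power_mult_distrib mult_ac)
    also have "x powr \<kappa> * (x powr (1 + \<delta>)) ^ (r - 1) = x powr ((real r - 1) * (1 + \<delta>) + \<kappa>)"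
    proof -
      have "(x powr (1 + \<delta>)) ^ (r - 1) = x powr ((real r - 1) * (1 + \<delta>))"
        using x r by (simp add: powr_power mult.commute of_nat_diff)
      then show ?thesis by (simp add: powr_add mult.commute)
    qed
    also have "prime_weight K \<kappa> D * prime_weight K (1 - \<delta>) D ^ (r - 1) = prime_weight (K ^ r) \<sigma> D"
    proof -
      have "prime_weight K (1 - \<delta>) D ^ (r - 1) = prime_weight (K ^ (r - 1)) (real (r - 1) * (1 - \<delta>)) D"
        using prime_setsD(2)[OF D] by (rule prime_weight_power)
      moreover have "K * K ^ (r - 1) = K ^ r" using r by (simp flip: power_Suc)
      ultimately show ?thesis
        using r by (simp add: prime_weight_mult \<sigma>_def of_nat_diff add.commute)
    qed
    finally show "\<bar>?d D\<bar> \<le> (real r * C3 * A ^ (r - 1) * x powr ((real r - 1) * (1 + \<delta>) + \<kappa>)) *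
        prime_weight (K ^ r) \<sigma> D" .
  qed
  then show ?thesis
    by (intro exI[of _ "real r * C3 * A ^ (r - 1) * G"]) (simp add: mult_ac)
qed

text \<open>The series for the top coefficient is a multiple of the expanded Euler product, so
  uniqueness of sums evaluates it. As it is nonzero, the degree does not drop.\<close>

lemma main_poly_lead:
  assumes "r \<ge> 2" "\<And>i. i \<in> {1..r} \<Longrightarrow> P i \<noteq> 0"
  shows "degree (main_poly r t P) = (\<Sum>i=1..r. degree (P i))"
    "lead_coeff (main_poly r t P) = Delta r t * (\<Prod>i=1..r. lead_coeff (P i))"
proof -
  define N where "N = (\<Sum>i=1..r. degree (P i))"
  have coeff: "coeff (main_poly r t P) j = (if j \<le> N then main_coeff r t P j else 0)" for j
    by (simp add: main_poly_def N_def coeff_sum)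
  have "((\<lambda>D. (\<Prod>i=1..r. lead_coeff (P i)) * ((-1) ^ card D * (\<Prod>p\<in>D. common_density r t p))) has_sum
      (\<Prod>i=1..r. lead_coeff (P i)) * Delta r t) prime_sets"
    by (intro has_sum_cmult_right Delta_has_sum assms)
  also have "?this \<longleftrightarrow> ((\<lambda>D. (-1) ^ card D * coeff (choice_prod r t P D) N) has_sum
      (\<Prod>i=1..r. lead_coeff (P i)) * Delta r t) prime_sets"
    unfolding N_def by (intro has_sum_cong) (simp only: choice_prod_degree(2) mult_ac)
  finally have lead: "main_coeff r t P N = (\<Prod>i=1..r. lead_coeff (P i)) * Delta r t"
    using main_coeff_has_sum[OF assms(1)] has_sum_unique by blast
  moreover have "(\<Prod>i=1..r. lead_coeff (P i)) \<noteq> 0"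
    using assms(2) by (simp add: prod_zero_iff)
  ultimately have "coeff (main_poly r t P) N \<noteq> 0"
    using Delta_nonzero[OF assms(1)] by (simp add: coeff)
  then have deg: "degree (main_poly r t P) = N"
    by (intro antisym le_degree degree_le) (auto simp: coeff)
  then show "degree (main_poly r t P) = (\<Sum>i=1..r. degree (P i))" by (simp add: N_def)
  show "lead_coeff (main_poly r t P) = Delta r t * (\<Prod>i=1..r. lead_coeff (P i))"
    unfolding deg using lead by (simp add: coeff)
qed

section \<open>The trivial estimate, for exponents at least 1\<close>

lemma coprime_sum_le:
  "(\<Sum>n\<in>coprime_tuples r x. \<Prod>i=1..r. real (piltz (t i) (n i))) \<le> (\<Prod>i=1..r. piltz_sum (t i) x)"
proof -
  define B where "B = {m::nat. 1 \<le> m \<and> real m \<le> x}"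
  have B: "finite B" by (simp add: B_def)
  have "(\<Sum>n\<in>coprime_tuples r x. \<Prod>i=1..r. real (piltz (t i) (n i))) \<le>
      (\<Sum>n\<in>{1..r} \<rightarrow>\<^sub>E B. \<Prod>i=1..r. real (piltz (t i) (n i)))"
    using B by (intro sum_mono2 finite_PiE) (auto simp: coprime_tuples_def B_def intro!: prod_nonneg)
  also have "\<dots> = (\<Prod>i=1..r. piltz_sum (t i) x)"
    unfolding piltz_sum_def using B by (subst prod_sum_PiE) (auto simp: B_def)
  finally show ?thesis .
qed

lemma trivial_asymptotics:
  assumes "\<epsilon> > 0"
  shows "(\<lambda>x. (\<Sum>n\<in>coprime_tuples r x. \<Prod>i=1..r. real (piltz (t i) (n i))) - x ^ r * poly Q (ln x))
    \<in> O[at_top](\<lambda>x. x powr (real r + \<epsilon>))"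
proof (rule sum_in_bigo)
  \<comment> \<open>This makes \<open>r * (1 + \<delta>)\<close> at most
    \<open>r + \<epsilon>\<close>, also when \<open>r = 0\<close>.\<close>
  define \<delta> where "\<delta> = \<epsilon> / (real r + 1)"
  have \<delta>: "\<delta> > 0" using assms by (simp add: \<delta>_def)
  have "\<exists>C>0. \<forall>i\<in>{1..r}. \<forall>x\<in>{1::real..}. piltz_sum (t i) x \<le> C * x powr (1 + \<delta>)"
  proof (rule uniform_const)
    fix i
    obtain C where "C > 0" "\<And>x. x > 0 \<Longrightarrow> piltz_sum (t i) x \<le> C * x powr (1 + \<delta>)"
      using piltz_sum_le_powr[OF \<delta>] by blast
    then show "\<exists>C>0. \<forall>x\<in>{1::real..}. piltz_sum (t i) x \<le> C * x powr (1 + \<delta>)"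
      by (intro exI[of _ C]) auto
  qed auto
  then obtain C where C: "C > 0"
    "\<And>i x. i \<in> {1..r} \<Longrightarrow> x \<ge> 1 \<Longrightarrow> piltz_sum (t i) x \<le> C * x powr (1 + \<delta>)"
    by (metis atLeast_iff)
  show "(\<lambda>x. \<Sum>n\<in>coprime_tuples r x. \<Prod>i=1..r. real (piltz (t i) (n i))) \<in> O[at_top](\<lambda>x. x powr (real r + \<epsilon>))"
  proof (rule bigoI, rule eventually_at_top_linorderI)
    fix x :: real assume x: "x \<ge> 1"
    have "(\<Sum>n\<in>coprime_tuples r x. \<Prod>i=1..r. real (piltz (t i) (n i))) \<le> (\<Prod>i=1..r. piltz_sum (t i) x)"
      by (rule coprime_sum_le)
    also have "\<dots> \<le> (\<Prod>i=1..r. C * x powr (1 + \<delta>))"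
      using C x by (intro prod_mono) (auto simp: piltz_sum_nonneg)
    also have "\<dots> = C ^ r * x powr (real r * (1 + \<delta>))"
      using x by (simp add: power_mult_distrib powr_power mult.commute)
    also have "\<dots> \<le> C ^ r * x powr (real r + \<epsilon>)"
      using x C assms by (intro mult_left_mono powr_mono) (auto simp: \<delta>_def field_simps)
    finally show "norm (\<Sum>n\<in>coprime_tuples r x. \<Prod>i=1..r. real (piltz (t i) (n i))) \<le>
        C ^ r * norm (x powr (real r + \<epsilon>))"
      by (simp add: sum_nonneg prod_nonneg)
  qed
  obtain A n where A: "A > 0" "\<And>u. \<bar>poly Q u\<bar> \<le> A * (1 + \<bar>u\<bar>) ^ n"
    using abs_poly_le_power by blast
  obtain B where B: "B > 0" "\<And>y. y \<ge> 1 \<Longrightarrow> (1 + ln y) ^ n \<le> B * y powr \<epsilon>"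
    using power_ln_le_powr[OF assms] by blast
  show "(\<lambda>x. x ^ r * poly Q (ln x)) \<in> O[at_top](\<lambda>x. x powr (real r + \<epsilon>))"
  proof (rule bigoI, rule eventually_at_top_linorderI)
    fix x :: real assume x: "x \<ge> 1"
    have "\<bar>poly Q (ln x)\<bar> \<le> A * (1 + ln x) ^ n"
      using A(2)[of "ln x"] x by simp
    also have "\<dots> \<le> A * (B * x powr \<epsilon>)"
      using A B x by (intro mult_left_mono) auto
    finally have "x ^ r * \<bar>poly Q (ln x)\<bar> \<le> x ^ r * (A * (B * x powr \<epsilon>))"
      using x by (intro mult_left_mono) auto
    then show "norm (x ^ r * poly Q (ln x)) \<le> (A * B) * norm (x powr (real r + \<epsilon>))"
      using x by (simp add: abs_mult powr_add powr_realpow mult_ac)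
  qed
qed

theorem theorem11:
  fixes r :: nat and t :: "nat \<Rightarrow> nat" and \<theta> :: "nat \<Rightarrow> real"
  assumes "r \<ge> 2"
    and "\<And>i. i \<in> {1..r} \<Longrightarrow> t i \<ge> 2"
    and "\<And>i. i \<in> {1..r} \<Longrightarrow> piltz_exponent (t i) (\<theta> (t i))"
  shows "convergent_prod (Delta_term r t) \<and>
    (\<exists>Q :: real poly.
       degree Q = (\<Sum>i=1..r. t i) - r \<and>
       lead_coeff Q = Delta r t / (\<Prod>i=1..r. fact (t i - 1)) \<and>
       (\<forall>\<epsilon>>0. (\<lambda>x::real. (\<Sum>n \<in> coprime_tuples r x. \<Prod>i=1..r. real (piltz (t i) (n i)))
                   - x ^ r * poly Q (ln x))
                \<in> O[at_top](\<lambda>x. x powr (real r - 1 + Max ((\<lambda>i. \<theta> (t i)) ` {1..r}) + \<epsilon>))))"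
proof (intro conjI convergent_prod_Delta assms(1))
  define \<Theta> where "\<Theta> = Max ((\<lambda>i. \<theta> (t i)) ` {1..r})"
  have \<Theta>_ge: "\<theta> (t i) \<le> \<Theta>" if "i \<in> {1..r}" for i
    unfolding \<Theta>_def using that by (intro Max_ge) auto
  have one: "1 \<in> {1..r}" using assms(1) by simp
  have "0 \<le> \<theta> (t 1)"
    using piltz_exponent_nonneg[OF assms(3)[OF one]] assms(2)[OF one] by simp
  then have \<Theta>_nonneg: "\<Theta> \<ge> 0" using \<Theta>_ge[OF one] by simp
  have "\<forall>i\<in>{1..r}. \<exists>P. degree P = t i - 1 \<and> lead_coeff P = 1 / fact (t i - 1) \<and>
      (\<forall>\<epsilon>>0. (\<lambda>x. piltz_sum (t i) x - x * poly P (ln x)) \<in> O[at_top](\<lambda>x. x powr (\<theta> (t i) + \<epsilon>)))"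
    using assms(3) unfolding piltz_exponent_def piltz_sum_def[symmetric] by blast
  \<comment> \<open>The polynomials are fixed before \<open>\<epsilon>\<close>, hence so is the main
    polynomial built from them.\<close>
  from bchoice[OF this] obtain P where P_all: "\<forall>i\<in>{1..r}. degree (P i) = t i - 1 \<and>
      lead_coeff (P i) = 1 / fact (t i - 1) \<and> (\<forall>\<epsilon>>0.
        (\<lambda>x. piltz_sum (t i) x - x * poly (P i) (ln x)) \<in> O[at_top](\<lambda>x. x powr (\<theta> (t i) + \<epsilon>)))" ..
  have P: "degree (P i) = t i - 1" "lead_coeff (P i) = 1 / fact (t i - 1)"
    "\<And>\<epsilon>. \<epsilon> > 0 \<Longrightarrow>
      (\<lambda>x. piltz_sum (t i) x - x * poly (P i) (ln x)) \<in> O[at_top](\<lambda>x. x powr (\<theta> (t i) + \<epsilon>))"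
    if "i \<in> {1..r}" for i
    using bspec[OF P_all that] by (elim conjE; blast)+
  have P_nz: "P i \<noteq> 0" if "i \<in> {1..r}" for i
    using P(2)[OF that] by auto
  let ?Q = "main_poly r t P"
  have "(\<Sum>i=1..r. degree (P i)) = (\<Sum>i=1..r. t i - 1)"
    using P(1) by simp
  also have "\<dots> = (\<Sum>i=1..r. t i) - r"
  proof (subst sum_subtractf_nat)
    show "1 \<le> t i" if "i \<in> {1..r}" for i
      using assms(2)[OF that] by simp
  qed simp
  finally have deg: "degree ?Q = (\<Sum>i=1..r. t i) - r"
    using main_poly_lead(1)[OF assms(1) P_nz] by simp
  have "lead_coeff ?Q = Delta r t * (\<Prod>i=1..r. lead_coeff (P i))"
    using assms(1) P_nz by (rule main_poly_lead(2))
  also have "(\<Prod>i=1..r. lead_coeff (P i)) = (\<Prod>i=1..r. 1 / fact (t i - 1))"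
    by (intro prod.cong refl P(2))
  finally have lead: "lead_coeff ?Q = Delta r t / (\<Prod>i=1..r. fact (t i - 1))"
    by (simp add: prod_dividef)
  have "(\<lambda>x. (\<Sum>n\<in>coprime_tuples r x. \<Prod>i=1..r. real (piltz (t i) (n i))) - x ^ r * poly ?Q (ln x))
      \<in> O[at_top](\<lambda>x. x powr (real r - 1 + \<Theta> + \<epsilon>))" if \<epsilon>: "\<epsilon> > 0" for \<epsilon>
  proof (cases "\<Theta> \<ge> 1")
    \<comment> \<open>The allowed error exponent is then
      \<open>r + (\<Theta> - 1 + \<epsilon>)\<close>, and the main term itself is within the
      error.\<close>
    case True
    then show ?thesis
      using trivial_asymptotics[where \<epsilon> = "\<Theta> - 1 + \<epsilon>" and Q = ?Q] \<epsilon> by (simp add: algebra_simps)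
  next
    case False
    \<comment> \<open>The error lemma is used with \<open>\<kappa> = \<Theta> + \<eta>\<close>,
      which must stay below 1; half of \<open>\<epsilon>\<close> is kept for the losses in the other
      \<open>r - 1\<close> factors.\<close>
    define \<eta> where "\<eta> = min (\<epsilon> / 2) ((1 - \<Theta>) / 2)"
    define \<delta> where "\<delta> = \<eta> / real r"
    have \<eta>: "\<eta> > 0" "2 * \<eta> \<le> \<epsilon>" "\<Theta> + \<eta> < 1" "\<eta> < 1"
      using \<epsilon> False \<Theta>_nonneg by (auto simp: \<eta>_def min_def field_simps)
    have r\<delta>: "real r * \<delta> = \<eta>" using assms(1) by (simp add: \<delta>_def)
    have "\<delta> > 0" using \<eta>(1) assms(1) by (simp add: \<delta>_def)
    have "2 * \<delta> \<le> real r * \<delta>" using assms(1) \<open>\<delta> > 0\<close> by (intro mult_right_mono) auto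
    then have \<delta>: "\<delta> > 0" "\<delta> < \<eta>" using r\<delta> \<open>\<delta> > 0\<close> by auto
    have "\<exists>C. \<forall>x\<ge>1. \<bar>(\<Sum>n\<in>coprime_tuples r x. \<Prod>i=1..r. real (piltz (t i) (n i)))
        - x ^ r * poly ?Q (ln x)\<bar> \<le> C * x powr ((real r - 1) * (1 + \<delta>) + (\<Theta> + \<eta>))"
    proof (rule coprime_sum_error)
      \<comment> \<open>Since \<open>r * \<delta> = \<eta>\<close>, the left side equals
        \<open>r - 1 + \<Theta> + \<delta>\<close>; for \<open>r = 2\<close> and
        \<open>\<Theta> = 0\<close> it exceeds 1 only by \<open>\<delta>\<close>.\<close>
      show "(real r - 1) * (1 - \<delta>) + (\<Theta> + \<eta>) > 1"
        using r\<delta> \<delta> assms(1) \<Theta>_nonneg by (simp add: algebra_simps)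
      show "(\<lambda>x. piltz_sum (t i) x - x * poly (P i) (ln x)) \<in> O[at_top](\<lambda>x. x powr (\<Theta> + \<eta>))"
        if i: "i \<in> {1..r}" for i
        using P(3)[OF i, of "\<Theta> + \<eta> - \<theta> (t i)"] \<Theta>_ge[OF i] \<eta>(1) by simp
    qed (use assms(1) \<eta> \<delta> \<Theta>_nonneg in auto)
    then obtain C where C: "\<And>x. x \<ge> 1 \<Longrightarrow>
        \<bar>(\<Sum>n\<in>coprime_tuples r x. \<Prod>i=1..r. real (piltz (t i) (n i))) - x ^ r * poly ?Q (ln x)\<bar>
          \<le> C * x powr ((real r - 1) * (1 + \<delta>) + (\<Theta> + \<eta>))"
      by blast
    show ?thesis
    proof (rule bigoI, rule eventually_at_top_linorderI)
      fix x :: real assume x: "x \<ge> 1"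
      have "C * x powr ((real r - 1) * (1 + \<delta>) + (\<Theta> + \<eta>)) \<le>
          \<bar>C\<bar> * x powr ((real r - 1) * (1 + \<delta>) + (\<Theta> + \<eta>))"
        by (intro mult_right_mono) auto
      \<comment> \<open>The exponent on the left is
        \<open>r - 1 + \<Theta> + 2 * \<eta> - \<delta>\<close>.\<close>
      also have "\<dots> \<le> \<bar>C\<bar> * x powr (real r - 1 + \<Theta> + \<epsilon>)"
        using x r\<delta> \<delta> \<eta> by (intro mult_left_mono powr_mono) (auto simp: algebra_simps)
      finally show "norm ((\<Sum>n\<in>coprime_tuples r x. \<Prod>i=1..r. real (piltz (t i) (n i))) - x ^ r * poly ?Q (ln x))
          \<le> \<bar>C\<bar> * norm (x powr (real r - 1 + \<Theta> + \<epsilon>))"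
        using C[OF x] by simp
    qed
  qed
  with deg lead show "\<exists>Q :: real poly.
       degree Q = (\<Sum>i=1..r. t i) - r \<and>
       lead_coeff Q = Delta r t / (\<Prod>i=1..r. fact (t i - 1)) \<and>
       (\<forall>\<epsilon>>0. (\<lambda>x::real. (\<Sum>n \<in> coprime_tuples r x. \<Prod>i=1..r. real (piltz (t i) (n i)))
                   - x ^ r * poly Q (ln x))
                \<in> O[at_top](\<lambda>x. x powr (real r - 1 + Max ((\<lambda>i. \<theta> (t i)) ` {1..r}) + \<epsilon>)))"
    unfolding \<Theta>_def by blast
qed

end
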